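(* Let $M$ be a complex manifold, and let $\omega_1$ and $\omega_2$ be LCK-forms on $M$ having the same Lee form $\theta$. Then the following conditions are equivalent: (i) the Bott–Chern classes of $\omega_1$ and $\omega_2$ in $H^{1,1}_{\partial_\theta\bar\partial_\theta}(M)$ are equal; (ii) the LCK-structures $\omega_1$ and $\omega_2$ are equivalent up to a potential.
   Context: Let $M$ be a connected complex manifold with complex structure $I$. An LCK-form on $M$ is the fundamental form $\omega(X,Y)=g(IX,Y)$ of a Hermitian metric $g$ such that $d\omega=\theta\wedge\omega$ for some closed real 1-form $\theta$, called the Lee form. Put $d_\theta\eta=d\eta-\theta\wedge\eta$, with Hodge components $\partial_\theta=\partial-\theta^{1,0}$, $\bar\partial_\theta=\bar\partial-\theta^{0,1}$, and $$H^{1,1}_{\partial_\theta\bar\partial_\theta}(M)=\frac{\{\eta\in\Lambda^{1,1}(M):\ \partial_\theta\eta=0,\ \bar\partial_\theta\eta=0\}}{\partial_\theta\bar\partial_\theta\big(C^\infty(M,\mathbb{C})\big)}.$$ The class of an LCK-form with Lee form $\theta$ in this group is its Bott–Chern class. Equivalence up to a potential: let $\tilde M\to M$ be a connected Galois covering with deck group $\Gamma$ on which the pullback of $\theta$ is exact, $\theta=df$ with $f:\tilde M\to\mathbb{R}$, and let $\tilde\omega_i=e^{-f}\omega_i$ be the corresponding Kähler forms on $\tilde M$. Let $\chi:\Gamma\to\mathbb{R}^{>0}$ be the character with $\gamma^*e^{-f}=\chi(\gamma)e^{-f}$ for all $\gamma\in\Gamma$ (equivalently $\gamma^*\tilde\omega_i=\chi(\gamma)\tilde\omega_i$).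 The two structures are equivalent up to a potential if there is a smooth function $\varphi:\tilde M\to\mathbb{R}$ with $\tilde\omega_1-\tilde\omega_2=\sqrt{-1}\,\partial\bar\partial\varphi$ and $\gamma^*\varphi=\chi(\gamma)\varphi$ for all $\gamma\in\Gamma$. *)

theory Defs
  imports "HOL-Analysis.Analysis"
begin

section \<open>Complex manifolds\<close>

text \<open>The points of a manifold are the elements of a topological type. A chart is a pair
  \<open>(U, \<phi>)\<close> of a chart domain and a coordinate map; the values of \<open>\<phi>\<close> off \<open>U\<close> are irrelevant.\<close>

type_synonym ('a, 'n) chart = "'a set \<times> ('a \<Rightarrow> complex ^ 'n)"

definition chart_img :: "('a, 'n::finite) chart \<Rightarrow> (complex ^ 'n) set" where
  "chart_img c = snd c ` fst c"

definition chart_inv :: "('a, 'n::finite) chart \<Rightarrow> complex ^ 'n \<Rightarrow> 'a" where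
  "chart_inv c = inv_into (fst c) (snd c)"

definition holomorphic_map_on ::
    "(complex ^ 'n) set \<Rightarrow> (complex ^ 'n::finite \<Rightarrow> complex ^ 'm::finite) \<Rightarrow> bool" where
  "holomorphic_map_on S F \<longleftrightarrow>
     (\<forall>z\<in>S. \<exists>D. (F has_derivative D) (at z) \<and> (\<forall>a v. D (a *s v) = a *s D v))"

definition complex_atlas :: "('a::topological_space, 'n::finite) chart set \<Rightarrow> bool" where
  "complex_atlas A \<longleftrightarrow>
     (\<Union>c\<in>A. fst c) = UNIV \<and>
     (\<forall>c\<in>A. open (fst c) \<and> open (chart_img c) \<and>
            homeomorphism (fst c) (chart_img c) (snd c) (chart_inv c)) \<and>
     (\<forall>c\<in>A. \<forall>c'\<in>A. holomorphic_map_on (snd c ` (fst c \<inter> fst c')) (snd c' \<circ> chart_inv c))"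

text \<open>\<open>C\<^sup>\<infinity>\<close> maps on an open set: all iterated directional derivatives exist and are differentiable.\<close>

fun differentiable_order_on ::
    "nat \<Rightarrow> ('v::real_normed_vector) set \<Rightarrow> ('v \<Rightarrow> 'w::real_normed_vector) \<Rightarrow> bool" where
  "differentiable_order_on 0 S h \<longleftrightarrow> continuous_on S h"
| "differentiable_order_on (Suc k) S h \<longleftrightarrow>
     (\<forall>z\<in>S. h differentiable (at z)) \<and>
     (\<forall>v. differentiable_order_on k S (\<lambda>z. frechet_derivative h (at z) v))"

definition smooth_on :: "('v::real_normed_vector) set \<Rightarrow> ('v \<Rightarrow> 'w::real_normed_vector) \<Rightarrow> bool" where
  "smooth_on S h \<longleftrightarrow> (\<forall>k. differentiable_order_on k S h)"

definition smooth_function ::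
    "('a, 'n::finite) chart set \<Rightarrow> ('a \<Rightarrow> 'w::real_normed_vector) \<Rightarrow> bool" where
  "smooth_function A h \<longleftrightarrow> (\<forall>c\<in>A. smooth_on (chart_img c) (h \<circ> chart_inv c))"


section \<open>Tensor fields and differential forms\<close>

text \<open>A covariant tensor field is given by its local representatives: \<open>\<eta> c z vs\<close> is the value at
  the point with coordinates \<open>z\<close> in the chart \<open>c\<close> on the tangent vectors whose coordinates in \<open>c\<close>
  are the entries of the list \<open>vs\<close>. All tensors are complex-valued and multilinear over the reals,
  i.e. they are sections of the complexified tensor bundle. To make equality of tensor fields the
  equality of functions, a \<open>k\<close>-tensor vanishes at all irrelevant arguments: charts not in the atlas,
  points outside the chart image, lists of length other than \<open>k\<close>.\<close>

type_synonym ('a, 'n) tensor =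
  "('a, 'n) chart \<Rightarrow> complex ^ 'n \<Rightarrow> (complex ^ 'n) list \<Rightarrow> complex"

definition tensor_field ::
    "('a, 'n::finite) chart set \<Rightarrow> nat \<Rightarrow> ('a, 'n) tensor \<Rightarrow> bool" where
  "tensor_field A k \<eta> \<longleftrightarrow>
     (\<forall>c z vs. \<not> (c \<in> A \<and> z \<in> chart_img c \<and> length vs = k) \<longrightarrow> \<eta> c z vs = 0) \<and>
     (\<forall>c\<in>A. \<forall>z\<in>chart_img c. \<forall>vs. length vs = k \<longrightarrow>
        (\<forall>i<k. linear (\<lambda>v. \<eta> c z (vs[i := v])))) \<and>
     (\<forall>c\<in>A. \<forall>vs. length vs = k \<longrightarrow> smooth_on (chart_img c) (\<lambda>z. \<eta> c z vs)) \<and>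
     (\<forall>c\<in>A. \<forall>c'\<in>A. \<forall>x\<in>fst c \<inter> fst c'. \<forall>vs. length vs = k \<longrightarrow>
        \<eta> c (snd c x) vs =
        \<eta> c' (snd c' x)
          (map (frechet_derivative (snd c' \<circ> chart_inv c) (at (snd c x))) vs))"

definition diff_form ::
    "('a, 'n::finite) chart set \<Rightarrow> nat \<Rightarrow> ('a, 'n) tensor \<Rightarrow> bool" where
  "diff_form A k \<eta> \<longleftrightarrow> tensor_field A k \<eta> \<and>
     (\<forall>c z vs i j. i < j \<and> j < length vs \<and> vs ! i = vs ! j \<longrightarrow> \<eta> c z vs = 0)"

definition real_tensor :: "('a, 'n::finite) tensor \<Rightarrow> bool" where
  "real_tensor \<eta> \<longleftrightarrow> (\<forall>c z vs. \<eta> c z vs \<in> \<real>)"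

definition zero_form :: "('a, 'n::finite) tensor" where
  "zero_form = (\<lambda>c z vs. 0)"

definition function_form ::
    "('a, 'n::finite) chart set \<Rightarrow> ('a \<Rightarrow> complex) \<Rightarrow> ('a, 'n) tensor" where
  "function_form A h = (\<lambda>c z vs.
     if c \<in> A \<and> z \<in> chart_img c \<and> vs = [] then h (chart_inv c z) else 0)"

definition remove_nth :: "nat \<Rightarrow> 'v list \<Rightarrow> 'v list" where
  "remove_nth i vs = take i vs @ drop (Suc i) vs"

text \<open>Exterior derivative and wedge product with a 1-form, with the normalisation
  \<open>(\<alpha> \<and> \<beta>)(X, Y) = \<alpha>(X) \<beta>(Y) - \<alpha>(Y) \<beta>(X)\<close> for 1-forms.\<close>

definition ext_d ::
    "('a, 'n::finite) chart set \<Rightarrow> ('a, 'n) tensor \<Rightarrow> ('a, 'n) tensor" where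
  "ext_d A \<eta> = (\<lambda>c z vs.
     if c \<in> A \<and> z \<in> chart_img c then
       \<Sum>i<length vs.
         (-1) ^ i * frechet_derivative (\<lambda>y. \<eta> c y (remove_nth i vs)) (at z) (vs ! i)
     else 0)"

definition wedge1 :: "('a, 'n::finite) tensor \<Rightarrow> ('a, 'n) tensor \<Rightarrow> ('a, 'n) tensor" where
  "wedge1 \<alpha> \<beta> = (\<lambda>c z vs.
     \<Sum>i<length vs. (-1) ^ i * \<alpha> c z [vs ! i] * \<beta> c z (remove_nth i vs))"

text \<open>The component of type \<open>(p, q)\<close> of a form of degree \<open>p + q\<close>. A complex-valued form is
  extended complex-multilinearly to complexified tangent vectors \<open>v = v\<^sup>1\<^sup>,\<^sup>0 + v\<^sup>0\<^sup>,\<^sup>1\<close>, where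
  \<open>v\<^sup>1\<^sup>,\<^sup>0 = (v - \<i> \<otimes> I v) / 2\<close> and \<open>v\<^sup>0\<^sup>,\<^sup>1 = (v + \<i> \<otimes> I v) / 2\<close>. The component is the sum over all
  sets \<open>S\<close> of \<open>p\<close> slots of the form applied to the \<open>(1, 0)\<close>-parts in the slots in \<open>S\<close> and to the
  \<open>(0, 1)\<close>-parts in the others; expanding multilinearly gives the inner sum over the set \<open>T\<close> of
  slots where \<open>I v\<close> is taken. In a holomorphic chart \<open>I\<close> is multiplication by \<open>\<i>\<close>.\<close>

definition hodge :: "nat \<Rightarrow> nat \<Rightarrow> ('a, 'n::finite) tensor \<Rightarrow> ('a, 'n) tensor" where
  "hodge p q \<eta> = (\<lambda>c z vs.
     if length vs = p + q then
       (\<Sum>S | S \<subseteq> {..<p + q} \<and> card S = p. \<Sum>T\<in>Pow {..<p + q}.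
          (\<Prod>j\<in>T. if j \<in> S then - \<i> else \<i>) *
          \<eta> c z (map (\<lambda>j. if j \<in> T then \<i> *s (vs ! j) else vs ! j) [0..<p + q])) / 2 ^ (p + q)
     else 0)"

text \<open>The operators below are applied to forms \<open>\<eta>\<close> of type \<open>(p, q)\<close>; on those, the first two are
  \<open>\<partial>\<close> and its conjugate.\<close>

definition del ::
    "('a, 'n::finite) chart set \<Rightarrow> nat \<Rightarrow> nat \<Rightarrow> ('a, 'n) tensor \<Rightarrow> ('a, 'n) tensor" where
  "del A p q \<eta> = hodge (Suc p) q (ext_d A \<eta>)"

definition delbar ::
    "('a, 'n::finite) chart set \<Rightarrow> nat \<Rightarrow> nat \<Rightarrow> ('a, 'n) tensor \<Rightarrow> ('a, 'n) tensor" where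
  "delbar A p q \<eta> = hodge p (Suc q) (ext_d A \<eta>)"

definition twisted_del ::
    "('a, 'n::finite) chart set \<Rightarrow> ('a, 'n) tensor \<Rightarrow> nat \<Rightarrow> nat \<Rightarrow>
      ('a, 'n) tensor \<Rightarrow> ('a, 'n) tensor" where
  "twisted_del A \<theta> p q \<eta> = del A p q \<eta> - wedge1 (hodge 1 0 \<theta>) \<eta>"

definition twisted_delbar ::
    "('a, 'n::finite) chart set \<Rightarrow> ('a, 'n) tensor \<Rightarrow> nat \<Rightarrow> nat \<Rightarrow>
      ('a, 'n) tensor \<Rightarrow> ('a, 'n) tensor" where
  "twisted_delbar A \<theta> p q \<eta> = delbar A p q \<eta> - wedge1 (hodge 0 1 \<theta>) \<eta>"


section \<open>LCK forms and Bott--Chern classes\<close>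

definition hermitian_metric ::
    "('a, 'n::finite) chart set \<Rightarrow> ('a, 'n) tensor \<Rightarrow> bool" where
  "hermitian_metric A g \<longleftrightarrow> tensor_field A 2 g \<and> real_tensor g \<and>
     (\<forall>c\<in>A. \<forall>z\<in>chart_img c.
        (\<forall>v w. g c z [v, w] = g c z [w, v]) \<and>
        (\<forall>v. v \<noteq> 0 \<longrightarrow> 0 < Re (g c z [v, v])) \<and>
        (\<forall>v w. g c z [\<i> *s v, \<i> *s w] = g c z [v, w]))"

definition fundamental_form :: "('a, 'n::finite) tensor \<Rightarrow> ('a, 'n) tensor" where
  "fundamental_form g = (\<lambda>c z vs.
     if length vs = 2 then g c z [\<i> *s (vs ! 0), vs ! 1] else 0)"

definition lck_form ::
    "('a, 'n::finite) chart set \<Rightarrow> ('a, 'n) tensor \<Rightarrow> ('a, 'n) tensor \<Rightarrow> bool" where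
  "lck_form A \<theta> \<omega> \<longleftrightarrow>
     (\<exists>g. hermitian_metric A g \<and> \<omega> = fundamental_form g) \<and>
     diff_form A 1 \<theta> \<and> real_tensor \<theta> \<and> ext_d A \<theta> = zero_form \<and>
     ext_d A \<omega> = wedge1 \<theta> \<omega>"

definition bott_chern_closed ::
    "('a, 'n::finite) chart set \<Rightarrow> ('a, 'n) tensor \<Rightarrow> ('a, 'n) tensor set" where
  "bott_chern_closed A \<theta> =
     {\<eta>. diff_form A 2 \<eta> \<and> hodge 1 1 \<eta> = \<eta> \<and>
         twisted_del A \<theta> 1 1 \<eta> = zero_form \<and> twisted_delbar A \<theta> 1 1 \<eta> = zero_form}"

definition bott_chern_rel ::
    "('a, 'n::finite) chart set \<Rightarrow> ('a, 'n) tensor \<Rightarrow> ('a, 'n) tensor rel" where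
  "bott_chern_rel A \<theta> =
     {(\<eta>, \<eta>'). \<eta> \<in> bott_chern_closed A \<theta> \<and> \<eta>' \<in> bott_chern_closed A \<theta> \<and>
        (\<exists>h :: 'a \<Rightarrow> complex. smooth_function A h \<and>
           \<eta> - \<eta>' = twisted_del A \<theta> 0 1 (twisted_delbar A \<theta> 0 0 (function_form A h)))}"

definition bott_chern_cohomology ::
    "('a, 'n::finite) chart set \<Rightarrow> ('a, 'n) tensor \<Rightarrow> ('a, 'n) tensor set set" where
  "bott_chern_cohomology A \<theta> = bott_chern_closed A \<theta> // bott_chern_rel A \<theta>"

definition bott_chern_class ::
    "('a, 'n::finite) chart set \<Rightarrow> ('a, 'n) tensor \<Rightarrow> ('a, 'n) tensor \<Rightarrow> ('a, 'n) tensor set" where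
  "bott_chern_class A \<theta> \<eta> = bott_chern_rel A \<theta> `` {\<eta>}"

lemma bott_chern_class_in_cohomology:
  "\<eta> \<in> bott_chern_closed A \<theta> \<Longrightarrow> bott_chern_class A \<theta> \<eta> \<in> bott_chern_cohomology A \<theta>"
  unfolding bott_chern_class_def bott_chern_cohomology_def by (rule quotientI)


section \<open>Galois coverings and equivalence up to a potential\<close>

definition deck_group :: "('b::topological_space \<Rightarrow> 'a) \<Rightarrow> ('b \<Rightarrow> 'b) set" where
  "deck_group p = {\<gamma>. homeomorphism UNIV UNIV \<gamma> (inv \<gamma>) \<and> p \<circ> \<gamma> = p}"

definition connected_galois_covering ::
    "('b::topological_space \<Rightarrow> 'a::topological_space) \<Rightarrow> bool" where
  "connected_galois_covering p \<longleftrightarrow>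
     covering_space UNIV p UNIV \<and> connected (UNIV :: 'b set) \<and>
     (\<forall>x y. p x = p y \<longrightarrow> (\<exists>\<gamma>\<in>deck_group p. \<gamma> x = y))"

text \<open>The complex structure of the covering manifold: the charts of the base, lifted to the open
  sets on which the covering map is injective.\<close>

definition lifted_atlas ::
    "('b::topological_space \<Rightarrow> 'a) \<Rightarrow> ('a, 'n::finite) chart set \<Rightarrow> ('b, 'n) chart set" where
  "lifted_atlas p A =
     {(V, snd c \<circ> p) | V c. c \<in> A \<and> open V \<and> inj_on p V \<and> p ` V \<subseteq> fst c}"

lemma complex_atlas_lifted_atlas:
  fixes p :: "'b::topological_space \<Rightarrow> 'a::topological_space" and A :: "('a, 'n::finite) chart set"
  assumes A: "complex_atlas A" and p: "covering_space UNIV p UNIV"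
  shows "complex_atlas (lifted_atlas p A)"
proof -
  have cont: "continuous_on UNIV p" using p by (simp add: covering_space_def)
  have lh: "\<exists>T u q. y \<in> T \<and> open T \<and> open u \<and> homeomorphism T u p q" for y
    by (rule covering_space_local_homeomorphism[OF p UNIV_I, of y]) auto
  have opn: "open (p ` V)" if "open V" for V
  proof (subst open_subopen, intro ballI)
    fix x assume "x \<in> p ` V"
    then obtain y where y: "y \<in> V" "x = p y" by blast
    obtain T u q where T: "y \<in> T" "open T" "open u" "homeomorphism T u p q"
      using lh by blast
    have "openin (top_of_set T) (T \<inter> V)" using that by (simp add: openin_open_Int)
    hence "openin (top_of_set u) (p ` (T \<inter> V))" using homeomorphism_imp_open_map[OF T(4)] by blast
    hence "open (p ` (T \<inter> V))" using T(3) openin_open_trans by auto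
    thus "\<exists>W. open W \<and> x \<in> W \<and> W \<subseteq> p ` V" using y T(1) by blast
  qed
  have cA: "open (fst c)" "open (chart_img c)" "homeomorphism (fst c) (chart_img c) (snd c) (chart_inv c)"
    if "c \<in> A" for c using A that by (auto simp: complex_atlas_def)
  have cov: "\<exists>c\<in>lifted_atlas p A. y \<in> fst c" for y
  proof -
    obtain c where c: "c \<in> A" "p y \<in> fst c" using A unfolding complex_atlas_def by blast
    obtain T u q where T: "y \<in> T" "open T" "homeomorphism T u p q"
      using lh by blast
    let ?V = "T \<inter> p -` fst c"
    have "open ?V" using T cA(1)[OF c(1)] cont by (auto intro!: open_Int simp: open_vimage)
    moreover have "inj_on p ?V" by (rule inj_on_inverseI[of _ q]) (use homeomorphism_apply1[OF T(3)] in blast)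
    ultimately have "(?V, snd c \<circ> p) \<in> lifted_atlas p A" unfolding lifted_atlas_def using c(1) by blast
    thus ?thesis using c T(1) by force
  qed
  have hom: "open (chart_img k) \<and> homeomorphism (fst k) (chart_img k) (snd k) (chart_inv k)
       \<and> (\<forall>W. open W \<longrightarrow> open (snd k ` (fst k \<inter> W)))"
    if k: "k = (V, snd c \<circ> p)" and c: "c \<in> A" and V: "open V" "inj_on p V" "p ` V \<subseteq> fst c" for k V c
  proof -
    have inj: "inj_on (snd c) (fst c)" by (rule inj_on_inverseI[of _ "chart_inv c"]) (use homeomorphism_apply1[OF cA(3)[OF c]] in blast)
    have injk: "inj_on (snd c \<circ> p) V" using inj V by (simp add: comp_inj_on inj_on_subset)
    have contk: "continuous_on V (snd c \<circ> p)"
      using continuous_on_subset[OF homeomorphism_cont1[OF cA(3)[OF c]] V(3)] continuous_on_subset[OF cont, of V]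
      by (intro continuous_on_compose) auto
    have opn': "open (snd c ` W)" if W: "open W" "W \<subseteq> fst c" for W
    proof -
      have "openin (top_of_set (fst c)) W" using W by (simp add: openin_open_eq cA(1)[OF c] )
      hence "openin (top_of_set (chart_img c)) (snd c ` W)"
        using homeomorphism_imp_open_map[OF cA(3)[OF c]] by blast
      thus ?thesis using cA(2)[OF c] openin_open_trans by blast
    qed
    have o: "open ((snd c \<circ> p) ` (V \<inter> W))" if "open W" for W
      using opn'[OF opn[of "V \<inter> W"]] V that by (auto simp: image_comp open_Int)
    have "open (chart_img k)" using o[of UNIV] k by (simp add: chart_img_def)
    moreover have "homeomorphism V ((snd c \<circ> p) ` V) (snd c \<circ> p) (inv_into V (snd c \<circ> p))"
    proof (rule homeomorphismI)
      show "continuous_on ((snd c \<circ> p) ` V) (inv_into V (snd c \<circ> p))"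
      proof (rule continuous_on_inverse_open_map[OF contk refl])
        show "openin (top_of_set ((snd c \<circ> p) ` V)) ((snd c \<circ> p) ` U)"
          if "openin (top_of_set V) U" for U
        proof -
          have "open U" "U \<subseteq> V" using that V(1) openin_open_eq by blast+
          hence "open ((snd c \<circ> p) ` U)" using o[of U] by (simp add: Int_absorb1)
          thus ?thesis using \<open>U \<subseteq> V\<close> by (intro open_subset image_mono)
        qed
      qed (use inv_into_f_f[OF injk] in auto)
    qed (use contk inv_into_f_f[OF injk] in auto)
    ultimately show ?thesis using k o by (simp add: chart_img_def chart_inv_def)
  qed
  have tr: "holomorphic_map_on (snd k ` (fst k \<inter> fst k')) (snd k' \<circ> chart_inv k)"
    if k: "k = (V, snd c \<circ> p)" "c \<in> A" "open V" "inj_on p V" "p ` V \<subseteq> fst c"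
    and k': "k' = (V', snd c' \<circ> p)" "c' \<in> A" "open V'" "inj_on p V'" "p ` V' \<subseteq> fst c'" for k k' V V' c c'
    unfolding holomorphic_map_on_def
  proof
    fix z assume z: "z \<in> snd k ` (fst k \<inter> fst k')"
    let ?S = "snd k ` (fst k \<inter> fst k')"
    have oS: "open ?S" using hom[OF k] k'(1,3) by simp
    have eq: "(snd k' \<circ> chart_inv k) w = (snd c' \<circ> chart_inv c) w" if w: "w \<in> ?S" for w
    proof -
      obtain y where y: "y \<in> V" "y \<in> V'" "w = snd c (p y)" using w k k' by auto
      have "chart_inv k w = y" using homeomorphism_apply1[of "fst k" "chart_img k" "snd k" "chart_inv k" y] hom[OF k] y k(1) by force
      moreover have "chart_inv c w = p y" using homeomorphism_apply1[OF cA(3)[OF k(2)], of "p y"] y k(5) by auto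
      ultimately show ?thesis using k' by simp
    qed
    have "z \<in> snd c ` (fst c \<inter> fst c')" using z k k' by auto
    then obtain D where "((snd c' \<circ> chart_inv c) has_derivative D) (at z)" "\<forall>a v. D (a *s v) = a *s D v"
      using A k(2) k'(2) unfolding complex_atlas_def holomorphic_map_on_def by blast
    thus "\<exists>D. ((snd k' \<circ> chart_inv k) has_derivative D) (at z) \<and> (\<forall>a v. D (a *s v) = a *s D v)"
      using has_derivative_transform_within_open[OF _ oS z] eq by metis
  qed
  have el: "\<exists>V c. k = (V, snd c \<circ> p) \<and> c \<in> A \<and> open V \<and> inj_on p V \<and> p ` V \<subseteq> fst c"
    if "k \<in> lifted_atlas p A" for k using that unfolding lifted_atlas_def by blast
  show ?thesis
    unfolding complex_atlas_def
  proof (intro conjI ballI)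
    show "(\<Union>c\<in>lifted_atlas p A. fst c) = UNIV" using cov by blast
  next
    fix k assume "k \<in> lifted_atlas p A"
    from el[OF this] obtain V c where k: "k = (V, snd c \<circ> p)" "c \<in> A" "open V" "inj_on p V" "p ` V \<subseteq> fst c" by blast
    show "open (fst k)" using k by simp
    show "open (chart_img k)" "homeomorphism (fst k) (chart_img k) (snd k) (chart_inv k)" using hom[OF k] by blast+
    fix k' assume "k' \<in> lifted_atlas p A"
    from el[OF this] obtain V' c' where k': "k' = (V', snd c' \<circ> p)" "c' \<in> A" "open V'" "inj_on p V'" "p ` V' \<subseteq> fst c'" by blast
    show "holomorphic_map_on (snd k ` (fst k \<inter> fst k')) (snd k' \<circ> chart_inv k)" using tr[OF k k'] .
  qed
qed

text \<open>Pullback of a tensor field along \<open>F\<close>, from the atlas \<open>A\<close> to the atlas \<open>B\<close>; by the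
  transformation law in \<^const>\<open>tensor_field\<close> the choice of the chart around the image point is
  immaterial.\<close>

definition pullback ::
    "('b, 'm::finite) chart set \<Rightarrow> ('a, 'n::finite) chart set \<Rightarrow> ('b \<Rightarrow> 'a) \<Rightarrow>
      ('a, 'n) tensor \<Rightarrow> ('b, 'm) tensor" where
  "pullback B A F \<eta> = (\<lambda>c z vs.
     if c \<in> B \<and> z \<in> chart_img c then
       let x = F (chart_inv c z); c' = (SOME c'. c' \<in> A \<and> x \<in> fst c') in
         \<eta> c' (snd c' x) (map (frechet_derivative (snd c' \<circ> F \<circ> chart_inv c) (at z)) vs)
     else 0)"

text \<open>The Kaehler form \<open>e\<^sup>-\<^sup>f p\<^sup>*\<omega>\<close> on the covering.\<close>

definition covering_kaehler_form ::
    "('a, 'n::finite) chart set \<Rightarrow> ('b::topological_space \<Rightarrow> 'a) \<Rightarrow> ('b \<Rightarrow> real) \<Rightarrow>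
      ('a, 'n) tensor \<Rightarrow> ('b, 'n) tensor" where
  "covering_kaehler_form A p f \<omega> = (\<lambda>c z vs.
     complex_of_real (exp (- f (chart_inv c z))) * pullback (lifted_atlas p A) A p \<omega> c z vs)"

definition deck_character :: "('b \<Rightarrow> real) \<Rightarrow> ('b \<Rightarrow> 'b) \<Rightarrow> real" where
  "deck_character f \<gamma> = (THE a. 0 < a \<and> (\<forall>x. exp (- f (\<gamma> x)) = a * exp (- f x)))"

definition equivalent_up_to_potential ::
    "('a, 'n::finite) chart set \<Rightarrow> ('b::topological_space \<Rightarrow> 'a) \<Rightarrow> ('b \<Rightarrow> real) \<Rightarrow>
      ('a, 'n) tensor \<Rightarrow> ('a, 'n) tensor \<Rightarrow> bool" where
  "equivalent_up_to_potential A p f \<omega>\<^sub>1 \<omega>\<^sub>2 \<longleftrightarrow>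
     (\<exists>\<phi> :: 'b \<Rightarrow> real. smooth_function (lifted_atlas p A) \<phi> \<and>
        covering_kaehler_form A p f \<omega>\<^sub>1 - covering_kaehler_form A p f \<omega>\<^sub>2 =
          (\<lambda>c z vs. \<i> * del (lifted_atlas p A) 0 1 (delbar (lifted_atlas p A) 0 0
             (function_form (lifted_atlas p A) (complex_of_real \<circ> \<phi>))) c z vs) \<and>
        (\<forall>\<gamma>\<in>deck_group p. \<forall>x. \<phi> (\<gamma> x) = deck_character f \<gamma> * \<phi> x))"

end

theory Submission
  imports Defs
begin

text \<open>Write \<open>L\<^sub>\<theta>\<close> for the twisted operator \<open>twisted_del \<circ> twisted_delbar\<close> on functions and \<open>L\<close> for the
  untwisted one. On a lifted chart \<open>\<theta> = df\<close>, and conjugation by \<open>e\<^sup>-\<^sup>f\<close> untwists: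
  \<open>L(e\<^sup>-\<^sup>f h) = e\<^sup>-\<^sup>f L\<^sub>\<theta> h\<close>. Hence \<open>\<omega>\<^sub>1 - \<omega>\<^sub>2 = L\<^sub>\<theta> h\<close> on the base if and only if the Kaehler forms on the
  covering differ by \<open>L \<psi>\<close> with \<open>\<psi> = e\<^sup>-\<^sup>f p\<^sup>*h\<close>. The functions of this shape are exactly those on which
  the deck group acts through the character: \<open>f \<circ> \<gamma> - f\<close> is constant because both potentials have the
  same differential on a connected space, and conversely \<open>e\<^sup>f \<psi>\<close> is then invariant and descends along
  the Galois covering. Finally \<open>\<i> L\<close> is a real operator and the difference of the Kaehler forms is
  real, so the complex potential \<open>\<psi>\<close> may be replaced by \<open>\<i> Im \<psi>\<close>.\<close>

subsection \<open>Smooth maps\<close>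

lemma has_derivative_cong_open:
  assumes "open S" "z \<in> S" "\<And>y. y \<in> S \<Longrightarrow> f y = g y"
  shows "(f has_derivative D) (at z) \<longleftrightarrow> (g has_derivative D) (at z)"
  using has_derivative_transform_within_open[OF _ assms(1,2)] assms(3) by metis

lemma frechet_derivative_cong_open:
  assumes "open S" "z \<in> S" "\<And>y. y \<in> S \<Longrightarrow> f y = g y"
  shows "frechet_derivative f (at z) = frechet_derivative g (at z)"
  unfolding frechet_derivative_def using has_derivative_cong_open[OF assms] by simp

lemma frechet_derivative_eqI:
  "(f has_derivative D) (at z) \<Longrightarrow> frechet_derivative f (at z) = D"
  using frechet_derivative_at by metis

lemma differentiable_imp_has_frechet_derivative:
  "f differentiable (at z) \<Longrightarrow> (f has_derivative frechet_derivative f (at z)) (at z)"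
  using frechet_derivative_works by blast

lemma frechet_derivative_add:
  assumes "f differentiable (at z)" "g differentiable (at z)"
  shows "frechet_derivative (\<lambda>y. f y + g y) (at z) v
       = frechet_derivative f (at z) v + frechet_derivative g (at z) v"
  using frechet_derivative_eqI[OF has_derivative_add[OF
      assms[THEN differentiable_imp_has_frechet_derivative]]] by simp

lemma frechet_derivative_bounded_linear:
  assumes "bounded_linear L" "f differentiable (at z)"
  shows "frechet_derivative (\<lambda>y. L (f y)) (at z) v = L (frechet_derivative f (at z) v)"
  using frechet_derivative_eqI[OF bounded_linear.has_derivative[OF assms(1)
      differentiable_imp_has_frechet_derivative[OF assms(2)]]] by simp

lemma differentiable_bounded_linear:
  assumes "bounded_linear L" "f differentiable (at z)"
  shows "(\<lambda>y. L (f y)) differentiable (at z)"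
  using assms bounded_linear.has_derivative unfolding differentiable_def by blast

section \<open>Finite orders of differentiability\<close>

lemma differentiable_order_on_cong:
  assumes "open S" "\<And>z. z \<in> S \<Longrightarrow> f z = g z"
  shows "differentiable_order_on k S f \<longleftrightarrow> differentiable_order_on k S g"
  using assms(2)
proof (induction k arbitrary: f g)
  case 0
  then show ?case by (simp cong: continuous_on_cong)
next
  case (Suc k)
  have "f differentiable (at z) \<longleftrightarrow> g differentiable (at z)" if "z \<in> S" for z
    unfolding differentiable_def using has_derivative_cong_open[OF assms(1) that, of f g] Suc.prems by blast
  moreover have "differentiable_order_on k S (\<lambda>z. frechet_derivative f (at z) v)
      \<longleftrightarrow> differentiable_order_on k S (\<lambda>z. frechet_derivative g (at z) v)" for v
    by (rule Suc.IH) (use frechet_derivative_cong_open[OF assms(1), of _ f g] Suc.prems in auto)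
  ultimately show ?case by simp
qed

text \<open>Order \<open>Suc k\<close> speaks of derivatives but not of continuity of the map
  itself, so monotonicity in the order needs a proof: at the bottom it is continuity of
  differentiable maps, above that it passes to the directional derivatives.\<close>

lemma differentiable_order_on_lower:
  "differentiable_order_on (Suc k) S f \<Longrightarrow> differentiable_order_on k S f"
proof (induction k arbitrary: f)
  case 0
  then show ?case
    by (auto intro!: continuous_at_imp_continuous_on differentiable_imp_continuous_within)
next
  case (Suc k)
  have "differentiable_order_on k S (\<lambda>z. frechet_derivative f (at z) v)" for v
    using Suc.IH Suc.prems by fastforce
  with Suc.prems show ?case by simp
qed

text \<open>Derivatives are taken in the full space, not within \<open>S\<close>, so the condition
  at a point depends only on the germ there. This lets smoothness be checked on small lifted
  charts.\<close>

lemma differentiable_order_on_local: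
  assumes "\<And>z. z \<in> S \<Longrightarrow> \<exists>W. open W \<and> z \<in> W \<and> differentiable_order_on k W f"
  shows "differentiable_order_on k S f"
  using assms
proof (induction k arbitrary: f)
  case 0
  then show ?case
    by (force intro: continuous_at_imp_continuous_on simp: continuous_on_eq_continuous_at)
next
  case (Suc k)
  have "f differentiable (at z)" if "z \<in> S" for z
    using Suc.prems[OF that] by auto
  moreover have "differentiable_order_on k S (\<lambda>z. frechet_derivative f (at z) v)" for v
    by (rule Suc.IH) (use Suc.prems in force)
  ultimately show ?case by simp
qed

text \<open>Induction step of the closure lemmas below: an explicit derivative \<open>D\<close> can
  be recognised as built from maps of order \<open>k\<close>, which
  \<open>frechet_derivative\<close> does not show.\<close>

lemma differentiable_order_on_SucI:
  assumes "open S" "\<And>z. z \<in> S \<Longrightarrow> (f has_derivative D z) (at z)"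
    "\<And>v. differentiable_order_on k S (\<lambda>z. D z v)"
  shows "differentiable_order_on (Suc k) S f"
proof -
  have "frechet_derivative f (at z) v = D z v" if "z \<in> S" for z v
    using frechet_derivative_eqI[OF assms(2)[OF that]] by simp
  then have "differentiable_order_on k S (\<lambda>z. frechet_derivative f (at z) v)" for v
    using differentiable_order_on_cong[OF assms(1), of "\<lambda>z. frechet_derivative f (at z) v" "\<lambda>z. D z v"]
      assms(3) by blast
  with assms(2) show ?thesis by (auto simp: differentiable_def)
qed

lemma differentiable_order_on_SucD:
  assumes "differentiable_order_on (Suc k) S f"
  shows "\<And>z. z \<in> S \<Longrightarrow> (f has_derivative frechet_derivative f (at z)) (at z)"
    and "\<And>v. differentiable_order_on k S (\<lambda>z. frechet_derivative f (at z) v)"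
  using assms by (auto intro: differentiable_imp_has_frechet_derivative)

lemma differentiable_order_on_bounded_linear:
  assumes "open S" "bounded_linear L" "differentiable_order_on k S f"
  shows "differentiable_order_on k S (\<lambda>z. L (f z))"
  using assms(3)
proof (induction k arbitrary: f)
  case 0
  then show ?case
    using bounded_linear.continuous_on[OF assms(2)] by auto
next
  case (Suc k)
  note f = differentiable_order_on_SucD[OF Suc.prems]
  show ?case
    by (rule differentiable_order_on_SucI[OF assms(1) bounded_linear.has_derivative[OF assms(2) f(1)]
          Suc.IH[OF f(2)]])
qed

lemma differentiable_order_on_add:
  assumes "open S" "differentiable_order_on k S f" "differentiable_order_on k S g"
  shows "differentiable_order_on k S (\<lambda>z. f z + g z)"
  using assms(2,3)
proof (induction k arbitrary: f g)
  case 0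
  then show ?case by (auto intro: continuous_on_add)
next
  case (Suc k)
  note f = differentiable_order_on_SucD[OF Suc.prems(1)]
  note g = differentiable_order_on_SucD[OF Suc.prems(2)]
  show ?case
    by (rule differentiable_order_on_SucI[OF assms(1) has_derivative_add[OF f(1) g(1)]
          Suc.IH[OF f(2) g(2)]])
qed

text \<open>The product rule pairs a derivative of one factor with the other factor itself, so the
  induction hypothesis is applied to factors lowered to order \<open>k\<close>. A general bounded
  bilinear \<open>B\<close> covers products and \<open>scaleR\<close> at once.\<close>

lemma differentiable_order_on_bounded_bilinear:
  assumes "open S" "bounded_bilinear B" "differentiable_order_on k S f" "differentiable_order_on k S g"
  shows "differentiable_order_on k S (\<lambda>z. B (f z) (g z))"
  using assms(3,4)
proof (induction k arbitrary: f g)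
  case 0
  then show ?case using bounded_bilinear.continuous_on[OF assms(2)] by auto
next
  case (Suc k)
  note f = differentiable_order_on_SucD[OF Suc.prems(1)]
  note g = differentiable_order_on_SucD[OF Suc.prems(2)]
  note fg = Suc.prems[THEN differentiable_order_on_lower]
  show ?case
    by (rule differentiable_order_on_SucI[OF assms(1) bounded_bilinear.FDERIV[OF assms(2) f(1) g(1)]
          differentiable_order_on_add[OF assms(1) Suc.IH[OF fg(1) g(2)] Suc.IH[OF f(2) fg(2)]]])
qed

lemma has_derivative_exp_compose:
  fixes f :: "'v::real_normed_vector \<Rightarrow> real"
  assumes "f differentiable (at z)"
  shows "((\<lambda>y. exp (f y)) has_derivative (\<lambda>v. frechet_derivative f (at z) v * exp (f z))) (at z)"
  using has_derivative_exp[OF differentiable_imp_has_frechet_derivative[OF assms]] by (simp add: mult.commute)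

lemma differentiable_order_on_exp:
  fixes f :: "'v::real_normed_vector \<Rightarrow> real"
  assumes "open S" "differentiable_order_on k S f"
  shows "differentiable_order_on k S (\<lambda>z. exp (f z))"
  using assms(2)
proof (induction k)
  case 0
  then show ?case by (auto intro: continuous_on_exp)
next
  case (Suc k)
  have "differentiable_order_on k S (\<lambda>z. frechet_derivative f (at z) v * exp (f z))" for v
    using differentiable_order_on_bounded_bilinear[OF assms(1) bounded_bilinear_mult
        differentiable_order_on_SucD(2)[OF Suc.prems] Suc.IH[OF differentiable_order_on_lower[OF Suc.prems]]] .
  then show ?case
    using Suc.prems
    by (intro differentiable_order_on_SucI[OF assms(1) has_derivative_exp_compose]) auto
qed

section \<open>Closure properties of smooth maps\<close>

lemma smooth_on_differentiable: "smooth_on S f \<Longrightarrow> z \<in> S \<Longrightarrow> f differentiable (at z)"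
  unfolding smooth_on_def by (metis differentiable_order_on.simps(2))

lemma smooth_on_frechet_derivative:
  "smooth_on S f \<Longrightarrow> smooth_on S (\<lambda>z. frechet_derivative f (at z) v)"
  unfolding smooth_on_def by (metis differentiable_order_on.simps(2))

lemma smooth_on_imp_continuous_on: "smooth_on S f \<Longrightarrow> continuous_on S f"
  unfolding smooth_on_def by (metis differentiable_order_on.simps(1))

lemma smooth_on_cong:
  assumes "open S" "\<And>z. z \<in> S \<Longrightarrow> f z = g z"
  shows "smooth_on S f \<longleftrightarrow> smooth_on S g"
  unfolding smooth_on_def by (intro all_cong1 differentiable_order_on_cong assms)

lemma smooth_on_local:
  assumes "\<And>z. z \<in> S \<Longrightarrow> \<exists>W. open W \<and> z \<in> W \<and> smooth_on W f"
  shows "smooth_on S f"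
  unfolding smooth_on_def using assms differentiable_order_on_local unfolding smooth_on_def by metis

lemma smooth_on_subset:
  assumes "smooth_on S f" "T \<subseteq> S" "open S"
  shows "smooth_on T f"
  by (rule smooth_on_local) (use assms in blast)

lemma smooth_on_bounded_linear:
  "open S \<Longrightarrow> bounded_linear L \<Longrightarrow> smooth_on S f \<Longrightarrow> smooth_on S (\<lambda>z. L (f z))"
  unfolding smooth_on_def using differentiable_order_on_bounded_linear by blast

lemma smooth_on_add:
  "open S \<Longrightarrow> smooth_on S f \<Longrightarrow> smooth_on S g \<Longrightarrow> smooth_on S (\<lambda>z. f z + g z)"
  unfolding smooth_on_def using differentiable_order_on_add by blast

lemma smooth_on_bounded_bilinear:
  "open S \<Longrightarrow> bounded_bilinear B \<Longrightarrow> smooth_on S f \<Longrightarrow> smooth_on S g \<Longrightarrow> smooth_on S (\<lambda>z. B (f z) (g z))"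
  unfolding smooth_on_def using differentiable_order_on_bounded_bilinear by blast

lemma smooth_on_exp:
  fixes f :: "'v::real_normed_vector \<Rightarrow> real"
  shows "open S \<Longrightarrow> smooth_on S f \<Longrightarrow> smooth_on S (\<lambda>z. exp (f z))"
  unfolding smooth_on_def using differentiable_order_on_exp by blast

subsection \<open>Symmetry of second derivatives\<close>

text \<open>Two mean value theorems compute the second difference over a parallelogram: one along
  \<open>u\<close> for the increment in direction \<open>v\<close>, then one along \<open>v\<close>
  for the derivative along \<open>u\<close>. The second difference is symmetric in \<open>u\<close>
  and \<open>v\<close>, which the next lemma exploits.\<close>

lemma second_difference_mvt:
  fixes h :: "'v::real_normed_vector \<Rightarrow> real"
  assumes h: "smooth_on S h" and t: "0 < t"
    and sub: "\<And>a b. 0 \<le> a \<Longrightarrow> a \<le> t \<Longrightarrow> 0 \<le> b \<Longrightarrow> b \<le> t \<Longrightarrow> z + a *\<^sub>R u + b *\<^sub>R v \<in> S"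
  shows "\<exists>a b. 0 \<le> a \<and> a \<le> t \<and> 0 \<le> b \<and> b \<le> t \<and>
    h (z + t *\<^sub>R u + t *\<^sub>R v) - h (z + t *\<^sub>R u) - h (z + t *\<^sub>R v) + h z
    = t * t * frechet_derivative (\<lambda>y. frechet_derivative h (at y) u) (at (z + a *\<^sub>R u + b *\<^sub>R v)) v"
proof -
  let ?D = "\<lambda>y. frechet_derivative h (at y)"
  have line: "((\<lambda>s. q (w + s *\<^sub>R x)) has_derivative (\<lambda>r. r * frechet_derivative q (at (w + s *\<^sub>R x)) x)) (at s)"
    if "q differentiable (at (w + s *\<^sub>R x))" for q :: "'v \<Rightarrow> real" and w x s
  proof -
    have "((\<lambda>s. w + s *\<^sub>R x) has_derivative (\<lambda>r. r *\<^sub>R x)) (at s)"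
      by (auto intro!: derivative_eq_intros)
    moreover note q = differentiable_imp_has_frechet_derivative[OF that]
    ultimately have "((\<lambda>s. q (w + s *\<^sub>R x)) has_derivative
        (\<lambda>r. frechet_derivative q (at (w + s *\<^sub>R x)) (r *\<^sub>R x))) (at s)"
      by (rule has_derivative_compose)
    moreover have "linear (frechet_derivative q (at (w + s *\<^sub>R x)))"
      using q has_derivative_linear by blast
    ultimately show ?thesis by (simp add: linear_scale)
  qed
  have swap: "z + r *\<^sub>R v + s *\<^sub>R u = z + s *\<^sub>R u + r *\<^sub>R v" for r s
    by (simp add: add.assoc add.commute[of "r *\<^sub>R v"])
  \<comment> \<open>The second difference is \<open>?q t - ?q 0\<close>: the increment in direction
    \<open>v\<close>, viewed as a function of the step along \<open>u\<close>.\<close>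
  let ?q = "\<lambda>s. h (z + t *\<^sub>R v + s *\<^sub>R u) - h (z + s *\<^sub>R u)"
  have "\<exists>a\<in>{0<..<t}. ?q t - ?q 0
      = (\<lambda>r. r * ?D (z + t *\<^sub>R v + a *\<^sub>R u) u - r * ?D (z + a *\<^sub>R u) u) (t - 0)"
  proof (rule mvt_simple[OF t])
    fix a assume a: "0 \<le> a" "a \<le> t"
    have "z + t *\<^sub>R v + a *\<^sub>R u \<in> S" "z + a *\<^sub>R u \<in> S"
      using sub[of a t] sub[of a 0] a t by (simp_all add: swap)
    then have "h differentiable (at (z + t *\<^sub>R v + a *\<^sub>R u))" "h differentiable (at (z + a *\<^sub>R u))"
      by (auto intro: smooth_on_differentiable[OF h])
    then show "(?q has_derivative (\<lambda>r. r * ?D (z + t *\<^sub>R v + a *\<^sub>R u) u - r * ?D (z + a *\<^sub>R u) u))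
        (at a within {0..t})"
      by (intro has_derivative_diff has_derivative_at_withinI[OF line])
  qed
  then obtain a where "a \<in> {0<..<t}"
    and q: "?q t - ?q 0 = t * ?D (z + t *\<^sub>R v + a *\<^sub>R u) u - t * ?D (z + a *\<^sub>R u) u"
    unfolding diff_zero by blast
  then have a: "0 \<le> a" "a \<le> t" by auto
  let ?r = "\<lambda>s. ?D (z + a *\<^sub>R u + s *\<^sub>R v) u"
  have "\<exists>b\<in>{0<..<t}. ?r t - ?r 0
      = (\<lambda>r. r * frechet_derivative (\<lambda>y. ?D y u) (at (z + a *\<^sub>R u + b *\<^sub>R v)) v) (t - 0)"
  proof (rule mvt_simple[OF t])
    fix b assume b: "0 \<le> b" "b \<le> t"
    have "(\<lambda>y. ?D y u) differentiable (at (z + a *\<^sub>R u + b *\<^sub>R v))"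
      using smooth_on_differentiable[OF smooth_on_frechet_derivative[OF h]] sub[of a b] a b by blast
    then show "(?r has_derivative
        (\<lambda>r. r * frechet_derivative (\<lambda>y. ?D y u) (at (z + a *\<^sub>R u + b *\<^sub>R v)) v)) (at b within {0..t})"
      by (rule has_derivative_at_withinI[OF line[of "\<lambda>y. ?D y u" "z + a *\<^sub>R u" b v]])
  qed
  then obtain b where "b \<in> {0<..<t}"
    and r: "?r t - ?r 0 = t * frechet_derivative (\<lambda>y. ?D y u) (at (z + a *\<^sub>R u + b *\<^sub>R v)) v"
    unfolding diff_zero by blast
  then have b: "0 \<le> b" "b \<le> t" by auto
  have "?q t - ?q 0 = t * (?r t - ?r 0)"
    using q by (simp add: swap right_diff_distrib)
  also have "\<dots> = t * t * frechet_derivative (\<lambda>y. ?D y u) (at (z + a *\<^sub>R u + b *\<^sub>R v)) v"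
    unfolding r by simp
  finally have "h (z + t *\<^sub>R u + t *\<^sub>R v) - h (z + t *\<^sub>R u) - h (z + t *\<^sub>R v) + h z
      = t * t * frechet_derivative (\<lambda>y. ?D y u) (at (z + a *\<^sub>R u + b *\<^sub>R v)) v"
    by (simp add: swap)
  with a b show ?thesis by blast
qed

text \<open>If the inequality failed, continuity would let a number \<open>m\<close> separate the
  two iterated derivatives on a whole ball. A small second difference is \<open>t * t\<close> times
  a value of each of them inside that ball, a contradiction. The one-sided form suffices, as
  \<open>u\<close> and \<open>v\<close> may be exchanged.\<close>

lemma second_derivative_le:
  fixes h :: "'v::real_normed_vector \<Rightarrow> real"
  assumes h: "smooth_on S h" and S: "open S" "z \<in> S"
  shows "frechet_derivative (\<lambda>y. frechet_derivative h (at y) u) (at z) v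
       \<le> frechet_derivative (\<lambda>y. frechet_derivative h (at y) v) (at z) u"
proof (rule ccontr)
  let ?B = "\<lambda>u v y. frechet_derivative (\<lambda>y. frechet_derivative h (at y) u) (at y) v"
  assume "\<not> ?thesis"
  then obtain m where m: "?B v u z < m" "m < ?B u v z"
    using dense by (meson not_le)
  have c: "continuous_on S (?B u v)" for u v
    by (intro smooth_on_imp_continuous_on smooth_on_frechet_derivative h)
  have "open (S \<inter> ?B u v -` {m<..})" "open (S \<inter> ?B v u -` {..<m})"
    by (intro continuous_open_preimage c S open_greaterThan open_lessThan)+
  then have "open ((S \<inter> ?B u v -` {m<..}) \<inter> (S \<inter> ?B v u -` {..<m}))" by (rule open_Int)
  then obtain e where e: "e > 0" "ball z e \<subseteq> (S \<inter> ?B u v -` {m<..}) \<inter> (S \<inter> ?B v u -` {..<m})"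
    by (rule openE[of _ z]) (use m S in auto)
  \<comment> \<open>The summand 1 keeps \<open>N\<close> positive when \<open>u\<close> and
    \<open>v\<close> both vanish; with \<open>t * N = e / 2\<close> the whole parallelogram lies in
    the ball.\<close>
  define N where "N = norm u + norm v + 1"
  have N: "N > 0" unfolding N_def using norm_ge_zero[of u] norm_ge_zero[of v] by linarith
  define t where "t = e / (2 * N)"
  have t: "t > 0" "t * N < e" using e N by (auto simp: t_def)
  have in_ball: "z + a *\<^sub>R u + b *\<^sub>R v \<in> ball z e" if "0 \<le> a" "a \<le> t" "0 \<le> b" "b \<le> t" for a b
  proof -
    have "norm (a *\<^sub>R u + b *\<^sub>R v) \<le> a * norm u + b * norm v"
      using norm_triangle_ineq[of "a *\<^sub>R u" "b *\<^sub>R v"] that by simp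
    also have "\<dots> \<le> t * norm u + t * norm v"
      by (intro add_mono mult_right_mono) (use that in auto)
    also have "\<dots> < e" using t by (simp add: algebra_simps N_def)
    finally show ?thesis
      using dist_add_cancel[of z 0 "a *\<^sub>R u + b *\<^sub>R v"] by (simp add: add.assoc)
  qed
  have uv: "z + a *\<^sub>R u + b *\<^sub>R v \<in> S" if "0 \<le> a" "a \<le> t" "0 \<le> b" "b \<le> t" for a b
    using subsetD[OF e(2) in_ball[OF that]] by simp
  obtain a b where ab: "0 \<le> a" "a \<le> t" "0 \<le> b" "b \<le> t"
    "h (z + t *\<^sub>R u + t *\<^sub>R v) - h (z + t *\<^sub>R u) - h (z + t *\<^sub>R v) + h z
      = t * t * ?B u v (z + a *\<^sub>R u + b *\<^sub>R v)"
    using second_difference_mvt[OF h t(1) uv] by blast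
  have vu: "z + a *\<^sub>R v + b *\<^sub>R u \<in> S" if "0 \<le> a" "a \<le> t" "0 \<le> b" "b \<le> t" for a b
    using subsetD[OF e(2) in_ball[OF that(3,4,1,2)]] by (simp add: add.assoc add.commute[of "a *\<^sub>R v"])
  obtain a' b' where ab': "0 \<le> a'" "a' \<le> t" "0 \<le> b'" "b' \<le> t"
    "h (z + t *\<^sub>R v + t *\<^sub>R u) - h (z + t *\<^sub>R v) - h (z + t *\<^sub>R u) + h z
      = t * t * ?B v u (z + a' *\<^sub>R v + b' *\<^sub>R u)"
    using second_difference_mvt[OF h t(1) vu] by blast
  have "t * t * ?B u v (z + a *\<^sub>R u + b *\<^sub>R v) = t * t * ?B v u (z + a' *\<^sub>R v + b' *\<^sub>R u)"
    using ab(5) ab'(5) by (simp add: algebra_simps)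
  then have "?B u v (z + a *\<^sub>R u + b *\<^sub>R v) = ?B v u (z + a' *\<^sub>R v + b' *\<^sub>R u)" using t by simp
  moreover have "?B u v (z + a *\<^sub>R u + b *\<^sub>R v) > m"
    using subsetD[OF e(2) in_ball[OF ab(1-4)]] by simp
  moreover have "?B v u (z + a' *\<^sub>R v + b' *\<^sub>R u) < m"
    using subsetD[OF e(2) in_ball[OF ab'(3,4) ab'(1,2)]]
    by (simp add: add.assoc add.commute[of "a' *\<^sub>R v"])
  ultimately show False by simp
qed

text \<open>The mean value argument is about real functions, so symmetry is obtained for the real
  and imaginary parts; these are bounded linear and hence commute with derivatives.\<close>

lemma second_derivative_symmetric:
  fixes h :: "'v::real_normed_vector \<Rightarrow> complex"
  assumes h: "smooth_on S h" and S: "open S" "z \<in> S"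
  shows "frechet_derivative (\<lambda>y. frechet_derivative h (at y) u) (at z) v
       = frechet_derivative (\<lambda>y. frechet_derivative h (at y) v) (at z) u"
proof -
  have part: "L (frechet_derivative (\<lambda>y. frechet_derivative h (at y) u) (at z) v)
       = L (frechet_derivative (\<lambda>y. frechet_derivative h (at y) v) (at z) u)"
    if L: "bounded_linear L" for L :: "complex \<Rightarrow> real"
  proof -
    have eq: "frechet_derivative (\<lambda>y. frechet_derivative (\<lambda>y. L (h y)) (at y) a) (at z) b
        = L (frechet_derivative (\<lambda>y. frechet_derivative h (at y) a) (at z) b)" for a b
    proof -
      have "frechet_derivative (\<lambda>y. frechet_derivative (\<lambda>y. L (h y)) (at y) a) (at z)
          = frechet_derivative (\<lambda>y. L (frechet_derivative h (at y) a)) (at z)"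
        by (rule frechet_derivative_cong_open[OF S]
            frechet_derivative_bounded_linear[OF L smooth_on_differentiable[OF h]])+
      then show ?thesis
        by (simp add: frechet_derivative_bounded_linear[OF L
              smooth_on_differentiable[OF smooth_on_frechet_derivative[OF h] S(2)]])
    qed
    have "smooth_on S (\<lambda>y. L (h y))" by (rule smooth_on_bounded_linear[OF S(1) L h])
    from second_derivative_le[OF this S, of u v] second_derivative_le[OF this S, of v u]
    show ?thesis unfolding eq by simp
  qed
  show ?thesis by (rule complex_eqI[OF part[OF bounded_linear_Re] part[OF bounded_linear_Im]])
qed

subsection \<open>Hodge components in low degree\<close>

text \<open>Splits off one slot at a time, so that the sums over sets of slots in
  \<open>hodge\<close> unfold into explicit finite sums.\<close>

lemma sum_Pow_insert:
  assumes "finite A" "a \<notin> A"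
  shows "(\<Sum>T\<in>Pow (insert a A). f T) = (\<Sum>T\<in>Pow A. f T) + (\<Sum>T\<in>Pow A. f (insert a T))"
proof -
  have "inj_on (insert a) (Pow A)"
    using assms(2) by (auto simp: inj_on_def)
  moreover have "Pow A \<inter> insert a ` Pow A = {}" using assms(2) by auto
  ultimately show ?thesis
    unfolding Pow_insert using assms(1) by (simp add: sum.union_disjoint sum.reindex)
qed

text \<open>The cardinality constraint moves into the summand, leaving a sum over a full power set
  to which \<open>sum_Pow_insert\<close> applies.\<close>

lemma hodge_eq_sum_Pow:
  "hodge p q \<eta> c z vs = (if length vs = p + q then
     (\<Sum>S\<in>Pow {..<p + q}. if card S = p then \<Sum>T\<in>Pow {..<p + q}.
          (\<Prod>j\<in>T. if j \<in> S then - \<i> else \<i>) *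
          \<eta> c z (map (\<lambda>j. if j \<in> T then \<i> *s (vs ! j) else vs ! j) [0..<p + q]) else 0) / 2 ^ (p + q)
     else 0)"
proof -
  have "{S. S \<subseteq> {..<p + q} \<and> card S = p} = {S \<in> Pow {..<p + q}. card S = p}" by auto
  then show ?thesis
    unfolding hodge_def by (simp only: sum.inter_filter finite_Pow_iff finite_lessThan sum_divide_distrib[symmetric])
qed

lemma hodge_0_1:
  "hodge 0 1 \<eta> c z [v] = (\<eta> c z [v] + \<i> * \<eta> c z [\<i> *s v]) / 2"
  by (simp add: hodge_eq_sum_Pow lessThan_Suc sum_Pow_insert add_divide_distrib)

lemma hodge_1_0:
  "hodge 1 0 \<eta> c z [v] = (\<eta> c z [v] - \<i> * \<eta> c z [\<i> *s v]) / 2"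
  by (simp add: hodge_eq_sum_Pow lessThan_Suc sum_Pow_insert diff_divide_distrib)

text \<open>The terms with the complex structure applied in exactly one slot cancel between the two
  choices of \<open>S\<close>.\<close>

lemma hodge_1_1:
  "hodge 1 1 \<eta> c z [u, v] = (\<eta> c z [u, v] + \<eta> c z [\<i> *s u, \<i> *s v]) / 2"
  by (simp add: hodge_eq_sum_Pow lessThan_Suc sum_Pow_insert field_simps)

lemma complex_vector_i_i: "\<i> *s (\<i> *s v) = - (v :: complex ^ 'n::finite)"
  by (simp add: vec_eq_iff)

text \<open>For \<omega> of type (1, 1), wedging with the (1, 0)-part of \<theta> gives type (2, 1),
  and with the (0, 1)-part type (1, 2). Hence the single equation for the exterior derivative of an
  LCK form splits into the two twisted closedness conditions.\<close>

lemma hodge_wedge1_of_type_1_1: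
  assumes inv: "\<And>u v. \<omega> c z [\<i> *s u, \<i> *s v] = \<omega> c z [u, v]"
    and flip: "\<And>u v. \<omega> c z [\<i> *s u, v] = - \<omega> c z [u, \<i> *s v]"
  shows "hodge 2 1 (wedge1 \<theta> \<omega>) c z [u, v, w] = wedge1 (hodge 1 0 \<theta>) \<omega> c z [u, v, w]"
    and "hodge 1 2 (wedge1 \<theta> \<omega>) c z [u, v, w] = wedge1 (hodge 0 1 \<theta>) \<omega> c z [u, v, w]"
proof -
  \<comment> \<open>Oddness in the second slot comes from \<open>inv\<close> and \<open>flip\<close>
    together: both compute the value on \<open>\<i> *s u\<close> and
    \<open>\<i> *s v\<close>.\<close>
  have neg: "\<omega> c z [u, - v] = - \<omega> c z [u, v]" for u v
    using inv[of u v] flip[of u "\<i> *s v"] unfolding complex_vector_i_i by (metis minus_minus)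
  show "hodge 2 1 (wedge1 \<theta> \<omega>) c z [u, v, w] = wedge1 (hodge 1 0 \<theta>) \<omega> c z [u, v, w]"
    and "hodge 1 2 (wedge1 \<theta> \<omega>) c z [u, v, w] = wedge1 (hodge 0 1 \<theta>) \<omega> c z [u, v, w]"
    by (simp_all add: hodge_eq_sum_Pow[where p="Suc (Suc 0)"] hodge_eq_sum_Pow[where q="Suc (Suc 0)"]
        numeral_2_eq_2 lessThan_Suc sum_Pow_insert wedge1_def
        remove_nth_def hodge_1_0[unfolded One_nat_def] hodge_0_1[unfolded One_nat_def] inv flip complex_vector_i_i neg field_simps)
qed

subsection \<open>The twisted operators in coordinates\<close>

text \<open>Here \<open>t z v\<close> is the value at \<open>z\<close> on \<open>v\<close> of the twisting 1-form; the first summand of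
  \<open>twisted_ddbar\<close> is the \<open>(1, 1)\<close>-part of the 2-form \<open>twisted_d_dbar\<close>.\<close>

definition twisted_dbar ::
    "(complex ^ 'n \<Rightarrow> complex ^ 'n \<Rightarrow> complex) \<Rightarrow> (complex ^ 'n \<Rightarrow> complex) \<Rightarrow>
      complex ^ 'n::finite \<Rightarrow> complex ^ 'n \<Rightarrow> complex" where
  "twisted_dbar t H z v =
     (frechet_derivative H (at z) v + \<i> * frechet_derivative H (at z) (\<i> *s v)) / 2
     - (t z v + \<i> * t z (\<i> *s v)) / 2 * H z"

definition twisted_d_dbar ::
    "(complex ^ 'n \<Rightarrow> complex ^ 'n \<Rightarrow> complex) \<Rightarrow> (complex ^ 'n \<Rightarrow> complex) \<Rightarrow>
      complex ^ 'n::finite \<Rightarrow> complex ^ 'n \<Rightarrow> complex ^ 'n \<Rightarrow> complex" where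
  "twisted_d_dbar t H z u v =
     frechet_derivative (\<lambda>y. twisted_dbar t H y v) (at z) u
     - frechet_derivative (\<lambda>y. twisted_dbar t H y u) (at z) v"

definition twisted_ddbar ::
    "(complex ^ 'n \<Rightarrow> complex ^ 'n \<Rightarrow> complex) \<Rightarrow> (complex ^ 'n \<Rightarrow> complex) \<Rightarrow>
      complex ^ 'n::finite \<Rightarrow> complex ^ 'n \<Rightarrow> complex ^ 'n \<Rightarrow> complex" where
  "twisted_ddbar t H z u v =
     (twisted_d_dbar t H z u v + twisted_d_dbar t H z (\<i> *s u) (\<i> *s v)) / 2
     - ((t z u - \<i> * t z (\<i> *s u)) / 2 * twisted_dbar t H z v
        - (t z v - \<i> * t z (\<i> *s v)) / 2 * twisted_dbar t H z u)"

lemma hodge_eq_0: "length vs \<noteq> p + q \<Longrightarrow> hodge p q \<eta> c z vs = 0"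
  by (simp add: hodge_def)

lemma hodge_cong_0: "(\<And>vs. \<eta> c z vs = 0) \<Longrightarrow> hodge p q \<eta> c z vs = 0"
  by (simp add: hodge_def)

text \<open>\<open>function_form\<close> is cut off to 0 outside the chart image, so it is compared
  with \<open>h \<circ> chart_inv c\<close> only there; the image being open, the derivatives still
  agree.\<close>

lemma twisted_delbar_function_form:
  assumes "c \<in> A" "z \<in> chart_img c" "open (chart_img c)"
  shows "twisted_delbar A \<theta> 0 0 (function_form A h) c z [v]
       = twisted_dbar (\<lambda>z v. \<theta> c z [v]) (h \<circ> chart_inv c) z v"
proof -
  have "ext_d A (function_form A h) c z [v] = frechet_derivative (h \<circ> chart_inv c) (at z) v" for v
  proof -
    have "frechet_derivative (\<lambda>y. function_form A h c y []) (at z) = frechet_derivative (h \<circ> chart_inv c) (at z)"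
      by (rule frechet_derivative_cong_open[OF assms(3,2)]) (use assms(1) in \<open>simp add: function_form_def\<close>)
    then show ?thesis using assms by (simp add: ext_d_def remove_nth_def)
  qed
  then show ?thesis
    using assms(1,2) by (simp add: twisted_delbar_def delbar_def hodge_0_1[unfolded One_nat_def]
        wedge1_def remove_nth_def function_form_def twisted_dbar_def)
qed

lemma twisted_del_delbar_function_form:
  assumes "c \<in> A" "z \<in> chart_img c" "open (chart_img c)"
  shows "twisted_del A \<theta> 0 1 (twisted_delbar A \<theta> 0 0 (function_form A h)) c z [u, v]
       = twisted_ddbar (\<lambda>z v. \<theta> c z [v]) (h \<circ> chart_inv c) z u v"
proof -
  let ?b = "twisted_delbar A \<theta> 0 0 (function_form A h)"
  let ?t = "\<lambda>z v. \<theta> c z [v]" and ?H = "h \<circ> chart_inv c"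
  have b: "?b c y [v] = twisted_dbar ?t ?H y v" if "y \<in> chart_img c" for y v
    by (rule twisted_delbar_function_form[OF assms(1) that assms(3)])
  have "frechet_derivative (\<lambda>y. ?b c y [v]) (at z) = frechet_derivative (\<lambda>y. twisted_dbar ?t ?H y v) (at z)" for v
    by (rule frechet_derivative_cong_open[OF assms(3,2)]) (rule b)
  then have "ext_d A ?b c z [u, v] = twisted_d_dbar ?t ?H z u v" for u v
    using assms(1,2) by (simp add: ext_d_def remove_nth_def numeral_2_eq_2 twisted_d_dbar_def)
  then show ?thesis
    using assms(1,2) by (simp add: twisted_del_def del_def hodge_1_1[unfolded One_nat_def]
        hodge_1_0[unfolded One_nat_def] wedge1_def remove_nth_def twisted_ddbar_def b)
      (simp add: algebra_simps)
qed

lemma ext_d_outside: "\<not> (c \<in> A \<and> z \<in> chart_img c) \<Longrightarrow> ext_d A \<eta> c z vs = 0"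
  by (auto simp: ext_d_def)

text \<open>Equality of tensor fields is equality of functions, so later identities must be checked
  at irrelevant arguments too. In the wedge term \<open>remove_nth i vs\<close> is empty only for
  lists of length 1.\<close>

lemma twisted_delbar_function_form_eq_0:
  assumes "\<not> (c \<in> A \<and> z \<in> chart_img c \<and> length vs = 1)"
  shows "twisted_delbar A \<theta> 0 0 (function_form A h) c z vs = 0"
proof -
  have "wedge1 (hodge 0 1 \<theta>) (function_form A h) c z vs = 0"
    unfolding wedge1_def
  proof (rule sum.neutral, rule ballI)
    fix i assume "i \<in> {..<length vs}"
    then have "length vs = 1" if "remove_nth i vs = []"
      using that by (cases vs) (auto simp: remove_nth_def)
    then show "(- 1) ^ i * hodge 0 1 \<theta> c z [vs ! i] * function_form A h c z (remove_nth i vs) = 0"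
      using assms by (auto simp: function_form_def)
  qed
  moreover have "hodge 0 1 (ext_d A (function_form A h)) c z vs = 0"
    using assms hodge_eq_0[of vs 0 1] hodge_cong_0 ext_d_outside
    by (metis add_0)
  ultimately show ?thesis by (simp add: twisted_delbar_def delbar_def)
qed

lemma twisted_del_delbar_function_form_eq_0:
  assumes "\<not> (c \<in> A \<and> z \<in> chart_img c \<and> length vs = 2)"
  shows "twisted_del A \<theta> 0 1 (twisted_delbar A \<theta> 0 0 (function_form A h)) c z vs = 0"
proof -
  let ?b = "twisted_delbar A \<theta> 0 0 (function_form A h)"
  have "wedge1 (hodge 1 0 \<theta>) ?b c z vs = 0"
    unfolding wedge1_def
  proof (rule sum.neutral, rule ballI)
    fix i assume "i \<in> {..<length vs}"
    then have "length (remove_nth i vs) = length vs - 1" "vs \<noteq> []"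
      by (auto simp: remove_nth_def)
    then have "?b c z (remove_nth i vs) = 0"
      using assms by (intro twisted_delbar_function_form_eq_0) (cases vs; auto)
    then show "(- 1) ^ i * hodge 1 0 \<theta> c z [vs ! i] * ?b c z (remove_nth i vs) = 0" by simp
  qed
  moreover have "hodge 1 1 (ext_d A ?b) c z vs = 0"
    using assms hodge_eq_0[of vs 1 1] hodge_cong_0 ext_d_outside
    by (metis one_add_one)
  ultimately show ?thesis by (simp add: twisted_del_def del_def)
qed

lemma wedge1_zero_form: "wedge1 (hodge p q zero_form) \<eta> = (\<lambda>c z vs. 0)"
  by (simp add: wedge1_def hodge_def zero_form_def fun_eq_iff)

text \<open>The untwisted operators on the covering become instances of the twisted ones, so one set
  of coordinate formulas serves both.\<close>

lemma twisted_zero_form: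
  "twisted_del A zero_form p q \<eta> = del A p q \<eta>" "twisted_delbar A zero_form p q \<eta> = delbar A p q \<eta>"
  by (simp_all add: twisted_del_def twisted_delbar_def wedge1_zero_form fun_eq_iff)

section \<open>Locality and linearity of the coordinate operators\<close>

lemma twisted_dbar_cong_open:
  assumes "open S" "z \<in> S" "\<And>y. y \<in> S \<Longrightarrow> H y = H' y" "t z = t' z"
  shows "twisted_dbar t H z v = twisted_dbar t' H' z v"
  unfolding twisted_dbar_def using frechet_derivative_cong_open[OF assms(1-3)] assms by simp

lemma twisted_ddbar_cong_open:
  assumes S: "open S" "z \<in> S" and H: "\<And>y. y \<in> S \<Longrightarrow> H y = H' y" and t: "\<And>y. y \<in> S \<Longrightarrow> t y = t' y"
  shows "twisted_ddbar t H z u v = twisted_ddbar t' H' z u v"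
proof -
  have b: "twisted_dbar t H y v = twisted_dbar t' H' y v" if "y \<in> S" for y v
    by (rule twisted_dbar_cong_open[OF S(1) that]) (use H t that in auto)
  have "twisted_d_dbar t H z u v = twisted_d_dbar t' H' z u v" for u v
    unfolding twisted_d_dbar_def using frechet_derivative_cong_open[OF S b] by simp
  then show ?thesis unfolding twisted_ddbar_def using b[OF S(2)] t[OF S(2)] by simp
qed

lemma twisted_dbar_differentiable:
  assumes S: "open S" "z \<in> S" and H: "smooth_on S H"
    and t: "\<And>v. (\<lambda>y. t y v) differentiable (at z)"
  shows "(\<lambda>y. twisted_dbar t H y v) differentiable (at z)"
  unfolding twisted_dbar_def
  by (intro differentiable_diff differentiable_mult differentiable_add differentiable_divide t
      differentiable_const smooth_on_differentiable[OF _ S(2)] smooth_on_frechet_derivative H) auto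

text \<open>A form of type (0, 1) is complex antilinear. This later determines the (1, 1)-part of
  its wedge product with the twisting form.\<close>

lemma twisted_dbar_i:
  assumes t: "linear (t z)" and H: "H differentiable (at z)"
  shows "twisted_dbar t H z (\<i> *s v) = - \<i> * twisted_dbar t H z v"
proof -
  have "linear (frechet_derivative H (at z))"
    using H by (simp add: linear_frechet_derivative)
  then show ?thesis
    unfolding twisted_dbar_def complex_vector_i_i using t by (simp add: linear_neg field_simps)
qed

lemma twisted_dbar_add:
  assumes "H differentiable (at z)" "G differentiable (at z)"
  shows "twisted_dbar t (\<lambda>y. H y + G y) z v = twisted_dbar t H z v + twisted_dbar t G z v"
  unfolding twisted_dbar_def frechet_derivative_add[OF assms] by (simp add: field_simps)

lemma twisted_dbar_cmult:
  assumes "H differentiable (at z)"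
  shows "twisted_dbar t (\<lambda>y. a * H y) z v = a * twisted_dbar t H z v"
  unfolding twisted_dbar_def frechet_derivative_bounded_linear[OF bounded_linear_mult_right assms]
  by (simp add: field_simps)

lemma twisted_ddbar_add:
  assumes S: "open S" "z \<in> S" and H: "smooth_on S H" "smooth_on S G"
    and t: "\<And>v. (\<lambda>y. t y v) differentiable (at z)"
  shows "twisted_ddbar t (\<lambda>y. H y + G y) z u v = twisted_ddbar t H z u v + twisted_ddbar t G z u v"
proof -
  have b: "twisted_dbar t (\<lambda>y. H y + G y) y v = twisted_dbar t H y v + twisted_dbar t G y v" if "y \<in> S" for y v
    by (rule twisted_dbar_add[OF H[THEN smooth_on_differentiable[OF _ that]]])
  have "frechet_derivative (\<lambda>y. twisted_dbar t (\<lambda>y. H y + G y) y v) (at z) u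
      = frechet_derivative (\<lambda>y. twisted_dbar t H y v) (at z) u + frechet_derivative (\<lambda>y. twisted_dbar t G y v) (at z) u" for u v
    using frechet_derivative_cong_open[OF S b]
      frechet_derivative_add[OF H[THEN twisted_dbar_differentiable[OF S _ t]]] by simp
  then show ?thesis unfolding twisted_ddbar_def twisted_d_dbar_def b[OF S(2)] by (simp add: field_simps)
qed

lemma twisted_ddbar_cmult:
  assumes S: "open S" "z \<in> S" and H: "smooth_on S H"
    and t: "\<And>v. (\<lambda>y. t y v) differentiable (at z)"
  shows "twisted_ddbar t (\<lambda>y. a * H y) z u v = a * twisted_ddbar t H z u v"
proof -
  have b: "twisted_dbar t (\<lambda>y. a * H y) y v = a * twisted_dbar t H y v" if "y \<in> S" for y v
    by (rule twisted_dbar_cmult[OF smooth_on_differentiable[OF H that]])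
  have "frechet_derivative (\<lambda>y. twisted_dbar t (\<lambda>y. a * H y) y v) (at z) u
      = a * frechet_derivative (\<lambda>y. twisted_dbar t H y v) (at z) u" for u v
    using frechet_derivative_cong_open[OF S b]
      frechet_derivative_bounded_linear[OF bounded_linear_mult_right twisted_dbar_differentiable[OF S H t]] by simp
  then show ?thesis unfolding twisted_ddbar_def twisted_d_dbar_def b[OF S(2)] by (simp add: field_simps)
qed

text \<open>Since \<open>t\<close> is the differential of \<open>g\<close>, differentiating
  \<open>exp (- g) F\<close> gives \<open>exp (- g)\<close> times the derivative of \<open>F\<close>
  minus \<open>t F\<close>. Applied first to \<open>H\<close> and then to the values of
  \<open>twisted_dbar t H\<close>, this rule moves the weight out of both derivatives and leaves the
  twist behind.\<close>

lemma twisted_ddbar_exp: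
  fixes g :: "complex ^ 'n::finite \<Rightarrow> real"
  assumes S: "open S" "z \<in> S" and H: "smooth_on S H" and g: "smooth_on S g"
    and t: "\<And>y v. y \<in> S \<Longrightarrow> t y v = complex_of_real (frechet_derivative g (at y) v)"
  shows "twisted_ddbar (\<lambda>z v. 0) (\<lambda>y. exp (- g y) *\<^sub>R H y) z u v = exp (- g z) *\<^sub>R twisted_ddbar t H z u v"
proof -
  have e: "((\<lambda>y. exp (- g y)) has_derivative (\<lambda>v. - frechet_derivative g (at y) v * exp (- g y))) (at y)"
    if "y \<in> S" for y
    using has_derivative_exp[OF has_derivative_minus[OF
          differentiable_imp_has_frechet_derivative[OF smooth_on_differentiable[OF g that]]]]
    by (simp add: mult.commute)
  have D: "frechet_derivative (\<lambda>y. exp (- g y) *\<^sub>R F y) (at y) v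
      = exp (- g y) *\<^sub>R (frechet_derivative F (at y) v - t y v * F y)"
    if "y \<in> S" "F differentiable (at y)" for F y v
    using frechet_derivative_eqI[OF bounded_bilinear.FDERIV[OF bounded_bilinear_scaleR e[OF that(1)]
          differentiable_imp_has_frechet_derivative[OF that(2)]]]
    by (simp add: t[OF that(1)] algebra_simps scaleR_conv_of_real)
  have b: "twisted_dbar (\<lambda>z v. 0) (\<lambda>y. exp (- g y) *\<^sub>R H y) y v = exp (- g y) *\<^sub>R twisted_dbar t H y v"
    if "y \<in> S" for y v
    unfolding twisted_dbar_def D[OF that smooth_on_differentiable[OF H that]]
    by (simp add: algebra_simps scaleR_conv_of_real field_simps)
  have t_diff: "(\<lambda>y. t y v) differentiable (at z)" for v
  proof -
    have "(\<lambda>y. complex_of_real (frechet_derivative g (at y) v)) differentiable (at z)"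
      by (intro differentiable_bounded_linear[OF bounded_linear_of_real]
          smooth_on_differentiable[OF _ S(2)] smooth_on_frechet_derivative g)
    then show ?thesis
      unfolding differentiable_def
      using has_derivative_cong_open[OF S, of "\<lambda>y. t y v"
          "\<lambda>y. complex_of_real (frechet_derivative g (at y) v)"] t by blast
  qed
  have b': "frechet_derivative (\<lambda>y. twisted_dbar (\<lambda>z v. 0) (\<lambda>y. exp (- g y) *\<^sub>R H y) y v) (at z) u
      = exp (- g z) *\<^sub>R (frechet_derivative (\<lambda>y. twisted_dbar t H y v) (at z) u - t z u * twisted_dbar t H z v)"
    for u v
  proof -
    have "frechet_derivative (\<lambda>y. twisted_dbar (\<lambda>z v. 0) (\<lambda>y. exp (- g y) *\<^sub>R H y) y v) (at z)
        = frechet_derivative (\<lambda>y. exp (- g y) *\<^sub>R twisted_dbar t H y v) (at z)"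
      by (rule frechet_derivative_cong_open[OF S]) (rule b)
    then show ?thesis
      using D[OF S(2) twisted_dbar_differentiable[of S z H t, OF S H t_diff], of v u] by simp
  qed
  have d: "twisted_d_dbar (\<lambda>z v. 0) (\<lambda>y. exp (- g y) *\<^sub>R H y) z u v
      = exp (- g z) *\<^sub>R (twisted_d_dbar t H z u v - (t z u * twisted_dbar t H z v - t z v * twisted_dbar t H z u))" for u v
    unfolding twisted_d_dbar_def b' by (simp add: algebra_simps)
  have "linear (t z)"
  proof -
    have "linear (\<lambda>v. complex_of_real (frechet_derivative g (at z) v))"
      using linear_compose[OF linear_frechet_derivative[OF smooth_on_differentiable[OF g S(2)]]
          bounded_linear.linear[OF bounded_linear_of_real]] by (simp add: o_def)
    then show ?thesis using t[OF S(2)] by (metis (no_types, lifting) ext)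
  qed
  \<comment> \<open>By antilinearity of \<open>twisted_dbar t H\<close>, the (1, 1)-part of its
    wedge product with \<open>t\<close> is the wedge product with the (1, 0)-part of
    \<open>t\<close>, as in the definition of \<open>twisted_ddbar\<close>.\<close>
  note i = twisted_dbar_i[of t, OF this smooth_on_differentiable[OF H S(2)]]
  show ?thesis
    unfolding twisted_ddbar_def d i b[OF S(2)] by (simp add: algebra_simps scaleR_conv_of_real field_simps)
qed

section \<open>The untwisted operator and real potentials\<close>

text \<open>Symmetry of second derivatives cancels the terms without a factor \<i> and shows the
  remaining 2-form to be of type (1, 1) already. What is left is \<i>/2 times an operator with real
  coefficients, from which the behaviour under \<open>Im\<close> can be read off.\<close>

lemma ddbar_eq_second_derivatives:
  fixes H :: "complex ^ 'n::finite \<Rightarrow> complex"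
  assumes S: "open S" "z \<in> S" and H: "smooth_on S H"
  shows "twisted_ddbar (\<lambda>z v. 0) H z u v = \<i> / 2 *
     (frechet_derivative (\<lambda>y. frechet_derivative H (at y) (\<i> *s v)) (at z) u
      - frechet_derivative (\<lambda>y. frechet_derivative H (at y) (\<i> *s u)) (at z) v)"
proof -
  let ?B = "\<lambda>u v. frechet_derivative (\<lambda>y. frechet_derivative H (at y) v) (at z) u"
  have diff: "(\<lambda>y. frechet_derivative H (at y) v) differentiable (at z)" for v
    by (rule smooth_on_differentiable[OF smooth_on_frechet_derivative[OF H] S(2)])
  have sym: "?B u v = ?B v u" for u v
    by (rule second_derivative_symmetric[OF H S])
  have lin: "linear (\<lambda>u. ?B u v)" for v
    using linear_frechet_derivative[OF diff] .
  have neg: "?B (- u) v = - ?B u v" "?B u (- v) = - ?B u v" for u v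
    using linear_neg[OF lin] sym by metis+
  have "frechet_derivative (\<lambda>y. twisted_dbar (\<lambda>z v. 0) H y v) (at z) u = (?B u v + \<i> * ?B u (\<i> *s v)) / 2" for u v
  proof -
    have "((\<lambda>y. twisted_dbar (\<lambda>z v. 0) H y v) has_derivative (\<lambda>u. (?B u v + \<i> * ?B u (\<i> *s v)) / 2)) (at z)"
      unfolding twisted_dbar_def
      by (auto intro!: derivative_eq_intros differentiable_imp_has_frechet_derivative diff)
    then show ?thesis by (simp add: frechet_derivative_eqI)
  qed
  then have d: "twisted_d_dbar (\<lambda>z v. 0) H z u v = \<i> / 2 * (?B u (\<i> *s v) - ?B v (\<i> *s u))" for u v
    unfolding twisted_d_dbar_def using sym[of u v] by (simp add: field_simps)
  show ?thesis
    unfolding twisted_ddbar_def d complex_vector_i_i neg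
    using sym[of "\<i> *s u" v] sym[of "\<i> *s v" u] by (simp add: field_simps)
qed

text \<open>The operator is \<i>/2 times a real operator. If its value on \<open>H\<close> is real,
  then the real operator vanishes on the real part of \<open>H\<close> at these arguments, and only
  \<i> times the imaginary part contributes.\<close>

lemma ddbar_Im:
  fixes H :: "complex ^ 'n::finite \<Rightarrow> complex"
  assumes S: "open S" "z \<in> S" and H: "smooth_on S H"
    and real: "twisted_ddbar (\<lambda>z v. 0) H z u v \<in> \<real>"
  shows "\<i> * twisted_ddbar (\<lambda>z v. 0) (\<lambda>y. complex_of_real (Im (H y))) z u v = twisted_ddbar (\<lambda>z v. 0) H z u v"
proof -
  let ?L = "\<lambda>w. complex_of_real (Im w)"
  have L: "bounded_linear ?L"
    by (rule bounded_linear_compose[OF bounded_linear_of_real bounded_linear_Im])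
  have eq: "frechet_derivative (\<lambda>y. frechet_derivative (\<lambda>y. ?L (H y)) (at y) a) (at z) b
        = ?L (frechet_derivative (\<lambda>y. frechet_derivative H (at y) a) (at z) b)" for a b
  proof -
    have "frechet_derivative (\<lambda>y. frechet_derivative (\<lambda>y. ?L (H y)) (at y) a) (at z)
        = frechet_derivative (\<lambda>y. ?L (frechet_derivative H (at y) a)) (at z)"
      by (rule frechet_derivative_cong_open[OF S]
          frechet_derivative_bounded_linear[OF L smooth_on_differentiable[OF H]])+
    then show ?thesis
      by (simp add: frechet_derivative_bounded_linear[OF L
            smooth_on_differentiable[OF smooth_on_frechet_derivative[OF H] S(2)]])
  qed
  show ?thesis
    using real unfolding ddbar_eq_second_derivatives[OF S smooth_on_bounded_linear[OF S(1) L H]]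
      ddbar_eq_second_derivatives[OF S H] eq
    by (auto simp: complex_eq_iff complex_is_Real_iff)
qed

subsection \<open>Charts and tensor fields\<close>

lemma complex_atlas_chart:
  assumes "complex_atlas A" "c \<in> A"
  shows "open (fst c)" "open (chart_img c)"
    "homeomorphism (fst c) (chart_img c) (snd c) (chart_inv c)"
    and "x \<in> fst c \<Longrightarrow> snd c x \<in> chart_img c" "x \<in> fst c \<Longrightarrow> chart_inv c (snd c x) = x"
    and "z \<in> chart_img c \<Longrightarrow> chart_inv c z \<in> fst c" "z \<in> chart_img c \<Longrightarrow> snd c (chart_inv c z) = z"
proof -
  show h: "open (fst c)" "open (chart_img c)"
    "homeomorphism (fst c) (chart_img c) (snd c) (chart_inv c)"
    using assms unfolding complex_atlas_def by blast+
  show "x \<in> fst c \<Longrightarrow> snd c x \<in> chart_img c" "x \<in> fst c \<Longrightarrow> chart_inv c (snd c x) = x"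
    "z \<in> chart_img c \<Longrightarrow> chart_inv c z \<in> fst c" "z \<in> chart_img c \<Longrightarrow> snd c (chart_inv c z) = z"
    using h(3) unfolding homeomorphism_def by blast+
qed

lemma tensor_field_chart:
  assumes "tensor_field A n \<eta>" "c \<in> A" "z \<in> chart_img c" "length vs = n"
  shows "i < n \<Longrightarrow> linear (\<lambda>v. \<eta> c z (vs[i := v]))"
    and "smooth_on (chart_img c) (\<lambda>z. \<eta> c z vs)"
  using assms unfolding tensor_field_def by blast+

lemma tensor_field_eq_0:
  "tensor_field A n \<eta> \<Longrightarrow> \<not> (c \<in> A \<and> z \<in> chart_img c \<and> length vs = n) \<Longrightarrow> \<eta> c z vs = 0"
  unfolding tensor_field_def by blast

lemma tensor_field_transform:
  assumes "tensor_field A n \<eta>" "c \<in> A" "c' \<in> A" "x \<in> fst c \<inter> fst c'" "length vs = n"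
  shows "\<eta> c (snd c x) vs =
        \<eta> c' (snd c' x) (map (frechet_derivative (snd c' \<circ> chart_inv c) (at (snd c x))) vs)"
  using assms unfolding tensor_field_def by blast

lemma length_2E:
  assumes "length vs = 2"
  obtains u v where "vs = [u, v]"
  using assms by (auto simp: numeral_2_eq_2 length_Suc_conv)

lemma length_3E:
  assumes "length vs = 3"
  obtains u v w where "vs = [u, v, w]"
  using assms by (auto simp: numeral_3_eq_3 length_Suc_conv)

subsection \<open>LCK forms\<close>

lemma linear_scale_i: "linear (\<lambda>v :: complex ^ 'n::finite. \<i> *s v)"
  by (rule linearI) (simp_all add: vec_eq_iff)

text \<open>Invariance is applied to \<open>\<i> *s u\<close> and \<open>v\<close>, where
  multiplying twice by \<i> produces the sign.\<close>

lemma hermitian_metric_flip: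
  assumes "hermitian_metric A g" "c \<in> A" "z \<in> chart_img c"
  shows "g c z [\<i> *s u, v] = - g c z [u, \<i> *s v]"
proof -
  have "linear (\<lambda>u. g c z [u, w])" for w
    using assms tensor_field_chart(1)[of A 2 g c z "[u, w]" 0] by (simp add: hermitian_metric_def)
  from linear_neg[OF this, of "u"] have "g c z [- u, \<i> *s v] = - g c z [u, \<i> *s v]" .
  moreover have "g c z [\<i> *s (\<i> *s u), \<i> *s v] = g c z [\<i> *s u, v]"
    using assms unfolding hermitian_metric_def by blast
  ultimately show ?thesis by (simp add: complex_vector_i_i)
qed

text \<open>The transformation law survives the insertion of the complex structure because
  differentials of holomorphic transition maps commute with multiplication by \<i>.\<close>

lemma fundamental_form_tensor_field:
  assumes A: "complex_atlas A" and g: "hermitian_metric A g"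
  shows "tensor_field A 2 (fundamental_form g)"
proof -
  have tg: "tensor_field A 2 g" using g by (simp add: hermitian_metric_def)
  have lin: "linear (\<lambda>v. fundamental_form g c z (vs[i := v]))"
    if "c \<in> A" "z \<in> chart_img c" "length vs = 2" "i < 2" for c z vs i
  proof -
    obtain a b where vs: "vs = [a, b]" using \<open>length vs = 2\<close> by (rule length_2E)
    have "linear (\<lambda>v. g c z [v, b])" "linear (\<lambda>v. g c z [\<i> *s a, v])"
      using tensor_field_chart(1)[OF tg that(1,2), of "[a, b]" 0]
        tensor_field_chart(1)[OF tg that(1,2), of "[\<i> *s a, b]" 1] by simp_all
    moreover from linear_compose[OF linear_scale_i this(1)] have "linear (\<lambda>v. g c z [\<i> *s v, b])"
      by (simp add: o_def)
    moreover have "i = 0 \<or> i = 1" using that(4) by auto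
    ultimately show ?thesis by (auto simp: vs fundamental_form_def)
  qed
  have tr: "fundamental_form g c (snd c x) vs = fundamental_form g c' (snd c' x)
          (map (frechet_derivative (snd c' \<circ> chart_inv c) (at (snd c x))) vs)"
    if c: "c \<in> A" "c' \<in> A" and x: "x \<in> fst c \<inter> fst c'" and "length vs = 2" for c c' x vs
  proof -
    obtain a b where vs: "vs = [a, b]" using \<open>length vs = 2\<close> by (rule length_2E)
    have "holomorphic_map_on (snd c ` (fst c \<inter> fst c')) (snd c' \<circ> chart_inv c)"
      using A c by (auto simp: complex_atlas_def)
    then obtain D where D: "((snd c' \<circ> chart_inv c) has_derivative D) (at (snd c x))" "\<And>a v. D (a *s v) = a *s D v"
      using x unfolding holomorphic_map_on_def by blast
    show ?thesis
      using tensor_field_transform[OF tg c x, of "[\<i> *s a, b]"] D(2)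
      unfolding frechet_derivative_eqI[OF D(1)] by (simp add: vs fundamental_form_def)
  qed
  have sm: "smooth_on (chart_img c) (\<lambda>z. fundamental_form g c z vs)"
    if "c \<in> A" "length vs = 2" for c vs
    using tg that by (simp add: tensor_field_def fundamental_form_def)
  show ?thesis
    unfolding tensor_field_def
  proof (intro conjI allI ballI impI)
    show "fundamental_form g c z vs = 0" if "\<not> (c \<in> A \<and> z \<in> chart_img c \<and> length vs = 2)" for c z vs
      using tensor_field_eq_0[OF tg, of c z "[\<i> *s vs ! 0, vs ! 1]"] that by (auto simp: fundamental_form_def)
  qed (rule lin sm tr; assumption)+
qed

lemma fundamental_form_type_1_1:
  assumes "hermitian_metric A g" "c \<in> A" "z \<in> chart_img c"
  shows "fundamental_form g c z [\<i> *s u, \<i> *s v] = fundamental_form g c z [u, v]"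
    and "fundamental_form g c z [\<i> *s u, v] = - fundamental_form g c z [u, \<i> *s v]"
proof -
  have "g c z [\<i> *s (\<i> *s u), \<i> *s v] = g c z [\<i> *s u, v]"
    using assms unfolding hermitian_metric_def by blast
  then show "fundamental_form g c z [\<i> *s u, \<i> *s v] = fundamental_form g c z [u, v]"
    by (simp add: fundamental_form_def)
  show "fundamental_form g c z [\<i> *s u, v] = - fundamental_form g c z [u, \<i> *s v]"
    using hermitian_metric_flip[OF assms, of "\<i> *s u" v] by (simp add: fundamental_form_def)
qed

text \<open>Gives an LCK form a class in the Bott--Chern group. Type (1, 1) reflects the invariance
  of the metric; twisted closedness is the type decomposition of
  \<open>ext_d A \<omega> = wedge1 \<theta> \<omega>\<close>.\<close>

lemma lck_form_bott_chern_closed: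
  assumes A: "complex_atlas A" and "lck_form A \<theta> \<omega>"
  shows "\<omega> \<in> bott_chern_closed A \<theta>"
proof -
  from assms(2) obtain g where g: "hermitian_metric A g" and \<omega>: "\<omega> = fundamental_form g"
    and d: "ext_d A \<omega> = wedge1 \<theta> \<omega>"
    unfolding lck_form_def by blast
  have t\<omega>: "tensor_field A 2 \<omega>" unfolding \<omega> by (rule fundamental_form_tensor_field[OF A g])
  note \<omega>_0 = tensor_field_eq_0[OF t\<omega>]
  \<comment> \<open>Off the charts both sides are 0, so this identity and the next hold for all
    arguments.\<close>
  have inv: "\<omega> c z [\<i> *s u, \<i> *s v] = \<omega> c z [u, v]" for c z u v
    using fundamental_form_type_1_1(1)[OF g, of c z u v] \<omega>_0[of c z] unfolding \<omega> by metis
  have flip: "\<omega> c z [\<i> *s u, v] = - \<omega> c z [u, \<i> *s v]" for c z u v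
    using fundamental_form_type_1_1(2)[OF g, of c z u v] \<omega>_0[of c z] unfolding \<omega> by (metis neg_0_equal_iff_equal)
  \<comment> \<open>Everything reduces to \<open>g c z [\<i> *s u, u]\<close>, which equals its own
    negative by symmetry of \<open>g\<close> and \<open>hermitian_metric_flip\<close>.\<close>
  have "\<omega> c z vs = 0" if "i < j" "j < length vs" "vs ! i = vs ! j" for c z vs i j
  proof (cases "c \<in> A \<and> z \<in> chart_img c \<and> length vs = 2")
    case True
    then obtain u v where vs: "vs = [u, v]" using length_2E by blast
    then have "i = 0" "j = 1" using that by auto
    then have "v = u" using that vs by simp
    moreover have "g c z [\<i> *s u, u] = g c z [u, \<i> *s u]"
      using g True unfolding hermitian_metric_def by blast
    ultimately show ?thesis
      using hermitian_metric_flip[OF g, of c z u u] True by (simp add: vs \<omega> fundamental_form_def)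
  qed (rule \<omega>_0)
  then have df: "diff_form A 2 \<omega>" unfolding diff_form_def using t\<omega> by blast
  have hodge: "hodge 1 1 \<omega> = \<omega>"
  proof (intro ext)
    fix c z vs
    show "hodge 1 1 \<omega> c z vs = \<omega> c z vs"
    proof (cases "length vs = 2")
      case True
      then obtain u v where "vs = [u, v]" by (rule length_2E)
      then show ?thesis using hodge_1_1[of \<omega> c z u v] inv by simp
    next
      case False
      then show ?thesis using hodge_eq_0[of vs 1 1] \<omega>_0[of c z vs] by simp
    qed
  qed
  have tw: "twisted_del A \<theta> 1 1 \<omega> c z vs = 0 \<and> twisted_delbar A \<theta> 1 1 \<omega> c z vs = 0" for c z vs
  proof (cases "length vs = 3")
    case True
    then obtain u v w where "vs = [u, v, w]" by (rule length_3E)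
    then show ?thesis
      using hodge_wedge1_of_type_1_1[of \<omega> c z, OF inv flip]
      by (simp add: twisted_del_def twisted_delbar_def del_def delbar_def d numeral_2_eq_2)
  next
    case False
    have "\<omega> c z (remove_nth i vs) = 0" if "i < length vs" for i
      using False that by (intro \<omega>_0) (auto simp: remove_nth_def)
    then have "wedge1 \<alpha> \<omega> c z vs = 0" for \<alpha>
      unfolding wedge1_def by (intro sum.neutral) auto
    moreover have "hodge 2 1 \<eta> c z vs = 0" "hodge 1 2 \<eta> c z vs = 0" for \<eta>
      using False by (simp_all add: hodge_eq_0)
    ultimately show ?thesis
      by (simp add: twisted_del_def twisted_delbar_def del_def delbar_def numeral_2_eq_2)
  qed
  have tw0: "twisted_del A \<theta> 1 1 \<omega> = zero_form" "twisted_delbar A \<theta> 1 1 \<omega> = zero_form"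
    unfolding zero_form_def using tw by (intro ext; blast)+
  show ?thesis
    unfolding bott_chern_closed_def by (intro CollectI conjI df hodge tw0)
qed

lemma lck_form_tensor_field:
  assumes "complex_atlas A" "lck_form A \<theta> \<omega>"
  shows "tensor_field A 2 \<omega>"
  using lck_form_bott_chern_closed[OF assms] unfolding bott_chern_closed_def diff_form_def by blast

lemma lck_form_real:
  assumes "lck_form A \<theta> \<omega>"
  shows "\<omega> c z vs \<in> \<real>"
proof -
  obtain g where g: "real_tensor g" "\<omega> = fundamental_form g"
    using assms by (auto simp: lck_form_def hermitian_metric_def)
  have "g c z [\<i> *s (vs ! 0), vs ! 1] \<in> \<real>"
    using g(1) unfolding real_tensor_def by blast
  then show ?thesis by (simp add: g(2) fundamental_form_def)
qed

subsection \<open>Bott--Chern classes\<close>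

text \<open>Together with homogeneity below, this makes the image of smooth functions a linear
  subspace, so that \<open>bott_chern_rel\<close> is an equivalence.\<close>

lemma twisted_del_delbar_add:
  assumes A: "complex_atlas A" and \<theta>: "tensor_field A 1 \<theta>"
    and h: "smooth_function A h" "smooth_function A h'"
  shows "twisted_del A \<theta> 0 1 (twisted_delbar A \<theta> 0 0 (function_form A (\<lambda>x. h x + h' x))) c z vs
       = twisted_del A \<theta> 0 1 (twisted_delbar A \<theta> 0 0 (function_form A h)) c z vs
       + twisted_del A \<theta> 0 1 (twisted_delbar A \<theta> 0 0 (function_form A h')) c z vs"
proof (cases "c \<in> A \<and> z \<in> chart_img c \<and> length vs = 2")
  case True
  then obtain u v where vs: "vs = [u, v]" using length_2E by blast
  have c: "c \<in> A" "z \<in> chart_img c" "open (chart_img c)"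
    using True complex_atlas_chart(2)[OF A] by auto
  have "(\<lambda>z. \<theta> c z [v]) differentiable (at z)" for v
    using smooth_on_differentiable[OF tensor_field_chart(2)[OF \<theta> c(1,2)] c(2)] by simp
  then have "twisted_ddbar (\<lambda>z v. \<theta> c z [v]) (\<lambda>y. (h \<circ> chart_inv c) y + (h' \<circ> chart_inv c) y) z u v
      = twisted_ddbar (\<lambda>z v. \<theta> c z [v]) (h \<circ> chart_inv c) z u v
      + twisted_ddbar (\<lambda>z v. \<theta> c z [v]) (h' \<circ> chart_inv c) z u v"
    using h c(1) by (intro twisted_ddbar_add[OF c(3,2)]) (auto simp: smooth_function_def comp_def)
  then show ?thesis
    unfolding vs twisted_del_delbar_function_form[OF c] by (simp only: comp_def)
qed (simp only: twisted_del_delbar_function_form_eq_0 add_0 mult_zero_right not_False_eq_True)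

lemma twisted_del_delbar_cmult:
  assumes A: "complex_atlas A" and \<theta>: "tensor_field A 1 \<theta>" and h: "smooth_function A h"
  shows "twisted_del A \<theta> 0 1 (twisted_delbar A \<theta> 0 0 (function_form A (\<lambda>x. a * h x))) c z vs
       = a * twisted_del A \<theta> 0 1 (twisted_delbar A \<theta> 0 0 (function_form A h)) c z vs"
proof (cases "c \<in> A \<and> z \<in> chart_img c \<and> length vs = 2")
  case True
  then obtain u v where vs: "vs = [u, v]" using length_2E by blast
  have c: "c \<in> A" "z \<in> chart_img c" "open (chart_img c)"
    using True complex_atlas_chart(2)[OF A] by auto
  have "(\<lambda>z. \<theta> c z [v]) differentiable (at z)" for v
    using smooth_on_differentiable[OF tensor_field_chart(2)[OF \<theta> c(1,2)] c(2)] by simp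
  then have "twisted_ddbar (\<lambda>z v. \<theta> c z [v]) (\<lambda>y. a * (h \<circ> chart_inv c) y) z u v
      = a * twisted_ddbar (\<lambda>z v. \<theta> c z [v]) (h \<circ> chart_inv c) z u v"
    using h c(1) by (intro twisted_ddbar_cmult[OF c(3,2)]) (auto simp: smooth_function_def comp_def)
  then show ?thesis
    unfolding vs twisted_del_delbar_function_form[OF c] by (simp only: comp_def)
qed (simp only: twisted_del_delbar_function_form_eq_0 add_0 mult_zero_right not_False_eq_True)

lemma smooth_function_bounded_linear:
  assumes "complex_atlas A" "bounded_linear L" "smooth_function A h"
  shows "smooth_function A (\<lambda>x. L (h x))"
  using assms(3) unfolding smooth_function_def comp_def
  by (intro ballI smooth_on_bounded_linear[OF complex_atlas_chart(2)[OF assms(1)] assms(2)]) auto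

lemma smooth_function_add:
  assumes "complex_atlas A" "smooth_function A h" "smooth_function A h'"
  shows "smooth_function A (\<lambda>x. h x + h' x)"
  using assms(2,3) unfolding smooth_function_def comp_def
  by (intro ballI smooth_on_add complex_atlas_chart(2)[OF assms(1)]) auto

lemma differentiable_order_on_const: "differentiable_order_on k S (\<lambda>z. a)"
  by (induction k arbitrary: a) simp_all

lemma smooth_function_const: "smooth_function A (\<lambda>x. a)"
  by (simp add: smooth_function_def smooth_on_def comp_def differentiable_order_on_const)

text \<open>The witnesses are the functions 0, \<open>- h\<close> and \<open>h + h'\<close>; for
  reflexivity, 0 enters as a multiple by 0.\<close>

lemma equiv_bott_chern_rel:
  assumes A: "complex_atlas A" and \<theta>: "tensor_field A 1 \<theta>"
  shows "equiv (bott_chern_closed A \<theta>) (bott_chern_rel A \<theta>)"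
proof (rule equivI)
  let ?D = "\<lambda>h. twisted_del A \<theta> 0 1 (twisted_delbar A \<theta> 0 0 (function_form A h))"
  show "bott_chern_rel A \<theta> \<subseteq> bott_chern_closed A \<theta> \<times> bott_chern_closed A \<theta>"
    by (auto simp: bott_chern_rel_def)
  show "refl_on (bott_chern_closed A \<theta>) (bott_chern_rel A \<theta>)"
  proof (rule refl_onI)
    fix \<eta> assume "\<eta> \<in> bott_chern_closed A \<theta>"
    moreover have "\<eta> - \<eta> = ?D (\<lambda>x. 0)"
      using twisted_del_delbar_cmult[OF A \<theta> smooth_function_const, of 0 0] by (simp add: fun_eq_iff)
    ultimately show "(\<eta>, \<eta>) \<in> bott_chern_rel A \<theta>"
      using smooth_function_const unfolding bott_chern_rel_def by blast
  qed
  show "sym (bott_chern_rel A \<theta>)"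
  proof (rule symI)
    fix \<eta> \<eta>' assume "(\<eta>, \<eta>') \<in> bott_chern_rel A \<theta>"
    then obtain h where h: "smooth_function A h" "\<eta> - \<eta>' = ?D h"
      and c: "\<eta> \<in> bott_chern_closed A \<theta>" "\<eta>' \<in> bott_chern_closed A \<theta>"
      by (auto simp: bott_chern_rel_def)
    have "(\<eta>' - \<eta>) c z vs = - 1 * (\<eta> - \<eta>') c z vs" for c z vs by simp
    then have "\<eta>' - \<eta> = ?D (\<lambda>x. - 1 * h x)"
      unfolding h(2) by (intro ext) (simp only: twisted_del_delbar_cmult[OF A \<theta> h(1)])
    then show "(\<eta>', \<eta>) \<in> bott_chern_rel A \<theta>"
      using smooth_function_bounded_linear[OF A bounded_linear_mult_right h(1), of "- 1"] c
      unfolding bott_chern_rel_def by blast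
  qed
  show "trans (bott_chern_rel A \<theta>)"
  proof (rule transI)
    fix \<eta> \<eta>' \<eta>'' assume "(\<eta>, \<eta>') \<in> bott_chern_rel A \<theta>" "(\<eta>', \<eta>'') \<in> bott_chern_rel A \<theta>"
    then obtain h h' where h: "smooth_function A h" "\<eta> - \<eta>' = ?D h" "smooth_function A h'" "\<eta>' - \<eta>'' = ?D h'"
      and c: "\<eta> \<in> bott_chern_closed A \<theta>" "\<eta>'' \<in> bott_chern_closed A \<theta>"
      by (auto simp: bott_chern_rel_def)
    have "(\<eta> - \<eta>'') c z vs = (\<eta> - \<eta>') c z vs + (\<eta>' - \<eta>'') c z vs" for c z vs by simp
    then have "\<eta> - \<eta>'' = ?D (\<lambda>x. h x + h' x)"
      unfolding h(2,4) by (intro ext) (simp only: twisted_del_delbar_add[OF A \<theta> h(1,3)])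
    then show "(\<eta>, \<eta>'') \<in> bott_chern_rel A \<theta>"
      using smooth_function_add[OF A h(1,3)] c unfolding bott_chern_rel_def by blast
  qed
qed

lemma bott_chern_class_eq_iff:
  assumes "complex_atlas A" "tensor_field A 1 \<theta>"
    and "\<eta> \<in> bott_chern_closed A \<theta>" "\<eta>' \<in> bott_chern_closed A \<theta>"
  shows "bott_chern_class A \<theta> \<eta> = bott_chern_class A \<theta> \<eta>' \<longleftrightarrow>
    (\<exists>h. smooth_function A h \<and> \<eta> - \<eta>' = twisted_del A \<theta> 0 1 (twisted_delbar A \<theta> 0 0 (function_form A h)))"
  unfolding bott_chern_class_def eq_equiv_class_iff[OF equiv_bott_chern_rel[OF assms(1,2)] assms(3,4)]
  by (simp only: bott_chern_rel_def mem_Collect_eq case_prod_conv assms(3,4) simp_thms)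

subsection \<open>Lifted charts\<close>

lemma lifted_atlasE:
  assumes "k \<in> lifted_atlas p A"
  obtains V c where "k = (V, snd c \<circ> p)" "c \<in> A" "open V" "inj_on p V" "p ` V \<subseteq> fst c"
  using assms unfolding lifted_atlas_def by blast

text \<open>Lifted charts reuse the coordinates of the base, so in coordinates \<open>p\<close> is
  the identity; every comparison of the covering with the base rests on this.\<close>

lemma lifted_chart:
  assumes A: "complex_atlas A" and c: "c \<in> A" and V: "p ` V \<subseteq> fst c"
    and z: "z \<in> chart_img (V, snd c \<circ> p)"
  shows "chart_inv (V, snd c \<circ> p) z \<in> V"
    and "p (chart_inv (V, snd c \<circ> p) z) = chart_inv c z"
    and "z \<in> chart_img c"
proof -
  let ?y = "chart_inv (V, snd c \<circ> p) z"
  have z: "z \<in> (snd c \<circ> p) ` V" using z by (simp add: chart_img_def)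
  show y: "?y \<in> V" unfolding chart_inv_def using inv_into_into[OF z] by simp
  have zy: "snd c (p ?y) = z" unfolding chart_inv_def using f_inv_into_f[OF z] by simp
  have "p ?y \<in> fst c" using V y by blast
  then show "p ?y = chart_inv c z" "z \<in> chart_img c"
    using complex_atlas_chart(4,5)[OF A c, of "p ?y"] unfolding zy by simp_all
qed

lemma lifted_chart_inv_eq:
  assumes A: "complex_atlas A" and c: "c \<in> A" and V: "inj_on p V" "p ` V \<subseteq> fst c" and y: "y \<in> V"
  shows "chart_inv (V, snd c \<circ> p) (snd c (p y)) = y" "snd c (p y) \<in> chart_img (V, snd c \<circ> p)"
proof -
  show img: "snd c (p y) \<in> chart_img (V, snd c \<circ> p)" using y by (auto simp: chart_img_def)
  note l = lifted_chart[OF A c V(2) img]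
  have "p y \<in> fst c" using V(2) y by blast
  then have "p (chart_inv (V, snd c \<circ> p) (snd c (p y))) = p y"
    using l(2) complex_atlas_chart(5)[OF A c] by simp
  then show "chart_inv (V, snd c \<circ> p) (snd c (p y)) = y"
    using inj_onD[OF V(1) _ l(1) y] by blast
qed

lemma lifted_chart_exists:
  assumes A: "complex_atlas A" and p: "covering_space UNIV p UNIV" and c: "c \<in> A" and y: "p y \<in> fst c"
  obtains V where "y \<in> V" "open V" "inj_on p V" "p ` V \<subseteq> fst c"
proof -
  have cont: "continuous_on UNIV p" using p by (simp add: covering_space_def)
  obtain T u q where T: "y \<in> T" "openin (top_of_set UNIV) T" "homeomorphism T u p q"
    using covering_space_local_homeomorphism[OF p UNIV_I, of y] by metis
  have "open (p -` fst c)"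
    using open_vimage[OF complex_atlas_chart(1)[OF A c] cont] .
  then have "open (T \<inter> p -` fst c)" using T(2) by (simp add: open_Int)
  moreover have "inj_on p (T \<inter> p -` fst c)"
    by (rule inj_on_inverseI[of _ q]) (use homeomorphism_apply1[OF T(3)] in blast)
  ultimately show ?thesis using that[of "T \<inter> p -` fst c"] T(1) y by blast
qed

text \<open>As \<open>p\<close> is the identity in lifted coordinates, the pullback has the local
  representative of \<eta> itself. The chart picked by \<open>SOME\<close> may differ from
  \<open>c\<close>; the transformation law leads back to \<open>c\<close>.\<close>

lemma pullback_lifted_atlas:
  assumes A: "complex_atlas A" and p: "covering_space UNIV p UNIV" and \<eta>: "tensor_field A n \<eta>"
    and k: "k = (V, snd c \<circ> p)" and c: "c \<in> A" and V: "open V" "inj_on p V" "p ` V \<subseteq> fst c"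
    and z: "z \<in> chart_img k"
  shows "pullback (lifted_atlas p A) A p \<eta> k z vs = \<eta> c z vs"
proof -
  have kL: "k \<in> lifted_atlas p A" unfolding lifted_atlas_def k using c V by blast
  have lk: "p (chart_inv k y) = chart_inv c y" "y \<in> chart_img c" if "y \<in> chart_img k" for y
    using lifted_chart[OF A c V(3), of y] that unfolding k by blast+
  have ok: "open (chart_img k)" by (rule complex_atlas_chart(2)[OF complex_atlas_lifted_atlas[OF A p] kL])
  define x where "x = p (chart_inv k z)"
  define c' where "c' = (SOME c'. c' \<in> A \<and> x \<in> fst c')"
  have "(\<Union>c\<in>A. fst c) = UNIV" using A unfolding complex_atlas_def by blast
  then have "\<exists>c'. c' \<in> A \<and> x \<in> fst c'" by blast
  then have c': "c' \<in> A" "x \<in> fst c'" unfolding c'_def by (metis (mono_tags, lifting) someI_ex)+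
  have x: "x \<in> fst c" "snd c x = z"
    unfolding x_def lk(1)[OF z] using complex_atlas_chart(6,7)[OF A c lk(2)[OF z]] by blast+
  have eq: "pullback (lifted_atlas p A) A p \<eta> k z vs =
      \<eta> c' (snd c' x) (map (frechet_derivative (snd c' \<circ> p \<circ> chart_inv k) (at z)) vs)"
    unfolding pullback_def Let_def x_def[symmetric] c'_def[symmetric] using kL z by simp
  have D: "frechet_derivative (snd c' \<circ> p \<circ> chart_inv k) (at z) = frechet_derivative (snd c' \<circ> chart_inv c) (at z)"
    by (rule frechet_derivative_cong_open[OF ok z]) (simp add: lk(1))
  show ?thesis
  proof (cases "length vs = n")
    case True
    have "x \<in> fst c \<inter> fst c'" using x c' by blast
    from tensor_field_transform[OF \<eta> c c'(1) this True] show ?thesis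
      unfolding eq D x(2) ..
  next
    case False
    then show ?thesis
      unfolding eq using tensor_field_eq_0[OF \<eta>, of c z vs] tensor_field_eq_0[OF \<eta>, of c' "snd c' x"] by simp
  qed
qed

lemma pullback_outside:
  "\<not> (k \<in> B \<and> z \<in> chart_img k) \<Longrightarrow> pullback B A F \<eta> k z vs = 0"
  unfolding pullback_def by (rule if_not_P)

subsection \<open>The deck group and the character\<close>

text \<open>Since \<open>f\<close> is real, its differential can be expressed through the real
  function \<open>f \<circ> chart_inv k\<close>, which is the shape required of \<open>t\<close> in
  \<open>twisted_ddbar_exp\<close>.\<close>

lemma lee_form_potential:
  assumes A: "complex_atlas A" and p: "covering_space UNIV p UNIV" and \<theta>: "tensor_field A 1 \<theta>"
    and f: "smooth_function (lifted_atlas p A) f"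
    and df: "pullback (lifted_atlas p A) A p \<theta> =
         ext_d (lifted_atlas p A) (function_form (lifted_atlas p A) (complex_of_real \<circ> f))"
    and k: "k = (V, snd c \<circ> p)" and c: "c \<in> A" and V: "open V" "inj_on p V" "p ` V \<subseteq> fst c"
    and z: "z \<in> chart_img k"
  shows "\<theta> c z [v] = complex_of_real (frechet_derivative (f \<circ> chart_inv k) (at z) v)"
proof -
  let ?L = "lifted_atlas p A"
  have kL: "k \<in> ?L" unfolding lifted_atlas_def k using c V by blast
  have ok: "open (chart_img k)" by (rule complex_atlas_chart(2)[OF complex_atlas_lifted_atlas[OF A p] kL])
  have "f \<circ> chart_inv k differentiable (at z)"
    using smooth_on_differentiable[OF _ z] f kL unfolding smooth_function_def by blast
  then have D: "frechet_derivative (\<lambda>y. complex_of_real ((f \<circ> chart_inv k) y)) (at z) v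
      = complex_of_real (frechet_derivative (f \<circ> chart_inv k) (at z) v)"
    by (rule frechet_derivative_bounded_linear[OF bounded_linear_of_real])
  have "\<theta> c z [v] = ext_d ?L (function_form ?L (complex_of_real \<circ> f)) k z [v]"
    unfolding df[symmetric] by (rule pullback_lifted_atlas[OF A p \<theta> k c V z, symmetric])
  also have "\<dots> = frechet_derivative (\<lambda>y. function_form ?L (complex_of_real \<circ> f) k y []) (at z) v"
    using kL z by (simp add: ext_d_def remove_nth_def)
  also have "frechet_derivative (\<lambda>y. function_form ?L (complex_of_real \<circ> f) k y []) (at z)
      = frechet_derivative (\<lambda>y. complex_of_real ((f \<circ> chart_inv k) y)) (at z)"
    by (rule frechet_derivative_cong_open[OF ok z]) (simp add: function_form_def kL)
  finally show ?thesis using D by simp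
qed

text \<open>As \<open>p \<circ> \<gamma> = p\<close>, moving the domain by \<gamma> keeps the
  coordinate map and its image. With this pair of charts \<gamma> is the identity in coordinates,
  and \<open>f \<circ> \<gamma>\<close> and \<open>f\<close> become functions on the same open
  set.\<close>

lemma deck_group_chart:
  assumes A: "complex_atlas A" and \<gamma>: "\<gamma> \<in> deck_group p"
    and c: "c \<in> A" and V: "open V" "inj_on p V" "p ` V \<subseteq> fst c"
  shows "open (\<gamma> ` V)" "inj_on p (\<gamma> ` V)" "p ` \<gamma> ` V \<subseteq> fst c"
    and "chart_img (\<gamma> ` V, snd c \<circ> p) = chart_img (V, snd c \<circ> p)"
    and "z \<in> chart_img (V, snd c \<circ> p) \<Longrightarrow>
      chart_inv (\<gamma> ` V, snd c \<circ> p) z = \<gamma> (chart_inv (V, snd c \<circ> p) z)"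
proof -
  have hom: "homeomorphism UNIV UNIV \<gamma> (inv \<gamma>)" and pg: "p (\<gamma> x) = p x" for x
    using \<gamma> unfolding deck_group_def by (auto simp: fun_eq_iff)
  show "open (\<gamma> ` V)"
    using homeomorphism_imp_open_map[OF hom, of V] V(1) by simp
  show inj: "inj_on p (\<gamma> ` V)" using V(2) by (auto simp: inj_on_def pg)
  show sub: "p ` \<gamma> ` V \<subseteq> fst c" using V(3) by (auto simp: pg)
  show "chart_img (\<gamma> ` V, snd c \<circ> p) = chart_img (V, snd c \<circ> p)"
    by (simp add: chart_img_def image_image pg)
  assume z: "z \<in> chart_img (V, snd c \<circ> p)"
  let ?y = "chart_inv (V, snd c \<circ> p) z"
  note l = lifted_chart[OF A c V(3) z]
  have "snd c (p (\<gamma> ?y)) = z" unfolding pg l(2) by (rule complex_atlas_chart(7)[OF A c l(3)])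
  with lifted_chart_inv_eq(1)[OF A c inj sub, of "\<gamma> ?y"] l(1)
  show "chart_inv (\<gamma> ` V, snd c \<circ> p) z = \<gamma> ?y" by simp
qed

text \<open>In a chart and its translate by \<gamma>, both \<open>f\<close> and
  \<open>f \<circ> \<gamma>\<close> have differential \<theta>. Their difference is locally
  constant, hence constant on the connected covering.\<close>

lemma deck_group_potential_shift:
  fixes p :: "'b::topological_space \<Rightarrow> 'a::topological_space"
  assumes A: "complex_atlas A" and p: "covering_space UNIV p UNIV" and conn: "connected (UNIV :: 'b set)"
    and \<theta>: "tensor_field A 1 \<theta>" and f: "smooth_function (lifted_atlas p A) f"
    and df: "pullback (lifted_atlas p A) A p \<theta> =
         ext_d (lifted_atlas p A) (function_form (lifted_atlas p A) (complex_of_real \<circ> f))"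
    and \<gamma>: "\<gamma> \<in> deck_group p"
  shows "f (\<gamma> x) - f x = f (\<gamma> y) - f y"
proof -
  let ?L = "lifted_atlas p A"
  have "\<forall>\<^sub>F y in at x within UNIV. f (\<gamma> x) - f x = f (\<gamma> y) - f y" for x
  proof -
    have "(\<Union>c\<in>A. fst c) = UNIV" using A unfolding complex_atlas_def by blast
    then obtain c where c: "c \<in> A" "p x \<in> fst c" by blast
    obtain V where xV: "x \<in> V" and V: "open V" "inj_on p V" "p ` V \<subseteq> fst c"
      by (rule lifted_chart_exists[OF A p c])
    note W = deck_group_chart[OF A \<gamma> c(1) V]
    let ?k = "(V, snd c \<circ> p)" and ?l = "(\<gamma> ` V, snd c \<circ> p)"
    have kL: "?k \<in> ?L" "?l \<in> ?L" unfolding lifted_atlas_def using c V W by blast+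
    have ok: "open (chart_img ?k)" by (rule complex_atlas_chart(2)[OF complex_atlas_lifted_atlas[OF A p] kL(1)])
    have d0: "((\<lambda>z. (f \<circ> chart_inv ?l) z - (f \<circ> chart_inv ?k) z) has_derivative (\<lambda>v. 0)) (at z)"
      if z: "z \<in> chart_img ?k" for z
    proof -
      have z': "z \<in> chart_img ?l" using z W(4) by simp
      have "f \<circ> chart_inv ?k differentiable (at z)" "f \<circ> chart_inv ?l differentiable (at z)"
        using smooth_on_differentiable[OF _ z] smooth_on_differentiable[OF _ z'] f kL
        unfolding smooth_function_def by blast+
      then have "((\<lambda>z. (f \<circ> chart_inv ?l) z - (f \<circ> chart_inv ?k) z) has_derivative
          (\<lambda>v. frechet_derivative (f \<circ> chart_inv ?l) (at z) v - frechet_derivative (f \<circ> chart_inv ?k) (at z) v)) (at z)"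
        by (intro has_derivative_diff differentiable_imp_has_frechet_derivative)
      moreover have "frechet_derivative (f \<circ> chart_inv ?l) (at z) v = frechet_derivative (f \<circ> chart_inv ?k) (at z) v" for v
        using lee_form_potential[OF A p \<theta> f df refl c(1) V z, of v]
          lee_form_potential[OF A p \<theta> f df refl c(1) W(1-3) z', of v] by simp
      ultimately show ?thesis by simp
    qed
    let ?z = "snd c (p x)"
    have z: "?z \<in> chart_img ?k" by (rule lifted_chart_inv_eq(2)[OF A c(1) V(2,3) xV])
    \<comment> \<open>A ball is taken because a vanishing derivative forces constancy on convex
      sets.\<close>
    obtain e where e: "e > 0" "ball ?z e \<subseteq> chart_img ?k" using openE[OF ok z] .
    have "\<exists>a. \<forall>z\<in>ball ?z e. (f \<circ> chart_inv ?l) z - (f \<circ> chart_inv ?k) z = a"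
      by (rule has_derivative_zero_constant[OF convex_ball])
        (use d0 e(2) in \<open>blast intro: has_derivative_at_withinI\<close>)
    then obtain a where a: "\<And>z. z \<in> ball ?z e \<Longrightarrow> (f \<circ> chart_inv ?l) z - (f \<circ> chart_inv ?k) z = a" by blast
    have "continuous_on V (snd c \<circ> p)"
      using homeomorphism_cont1[OF complex_atlas_chart(3)[OF complex_atlas_lifted_atlas[OF A p] kL(1)]]
      unfolding fst_conv snd_conv .
    then have o: "open (V \<inter> (snd c \<circ> p) -` ball ?z e)"
      by (rule continuous_open_preimage[OF _ V(1) open_ball])
    have shift: "f (\<gamma> y) - f y = a" if "y \<in> V \<inter> (snd c \<circ> p) -` ball ?z e" for y
    proof -
      have y: "y \<in> V" "snd c (p y) \<in> ball ?z e" using that by auto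
      have inv: "chart_inv ?k (snd c (p y)) = y" by (rule lifted_chart_inv_eq(1)[OF A c(1) V(2,3) y(1)])
      show ?thesis
        using a[OF y(2)] W(5)[OF subsetD[OF e(2) y(2)]] inv by simp
    qed
    have "x \<in> V \<inter> (snd c \<circ> p) -` ball ?z e" using xV e(1) by simp
    with shift o show ?thesis
      unfolding eventually_at_topological by metis
  qed
  then show ?thesis
    using connected_local_const[OF conn UNIV_I UNIV_I, of "\<lambda>y. f (\<gamma> y) - f y" x y] by blast
qed

text \<open>Justifies the \<open>THE\<close> in \<open>deck_character\<close>: the shift of
  \<open>f\<close> is constant, so the exponential of its negative is a positive multiplier, unique
  because exponentials do not vanish.\<close>

lemma deck_character_works:
  assumes "\<And>x y. f (\<gamma> x) - f x = f (\<gamma> y) - f y"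
  shows "0 < deck_character f \<gamma>" "exp (- f (\<gamma> x)) = deck_character f \<gamma> * exp (- f x)"
proof -
  let ?P = "\<lambda>a. 0 < a \<and> (\<forall>x. exp (- f (\<gamma> x)) = a * exp (- f x))"
  have E: "exp (- f (\<gamma> y)) = exp (- (f (\<gamma> x) - f x)) * exp (- f y)" for y
    unfolding assms[of x y] by (simp flip: exp_add)
  have "?P (exp (- (f (\<gamma> x) - f x)))" using E by (intro conjI allI exp_gt_zero)
  moreover have "a = exp (- (f (\<gamma> x) - f x))" if "?P a" for a
  proof -
    have "a * exp (- f x) = exp (- (f (\<gamma> x) - f x)) * exp (- f x)"
      using that E[of x] by metis
    then show ?thesis by (simp only: mult_right_cancel[OF exp_not_eq_zero])
  qed
  ultimately have "?P (deck_character f \<gamma>)"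
    unfolding deck_character_def by (rule theI)
  then show "0 < deck_character f \<gamma>" "exp (- f (\<gamma> x)) = deck_character f \<gamma> * exp (- f x)" by blast+
qed

subsection \<open>Descent of potentials\<close>

lemma covering_kaehler_form_lifted:
  assumes A: "complex_atlas A" and p: "covering_space UNIV p UNIV" and \<omega>: "tensor_field A n \<omega>"
    and k: "k = (V, snd c \<circ> p)" and c: "c \<in> A" and V: "open V" "inj_on p V" "p ` V \<subseteq> fst c"
    and z: "z \<in> chart_img k"
  shows "covering_kaehler_form A p f \<omega> k z vs = exp (- f (chart_inv k z)) *\<^sub>R \<omega> c z vs"
  unfolding covering_kaehler_form_def pullback_lifted_atlas[OF A p \<omega> k c V z] scaleR_conv_of_real ..

lemma covering_kaehler_form_eq_0:
  assumes A: "complex_atlas A" and p: "covering_space UNIV p UNIV" and \<omega>: "tensor_field A n \<omega>"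
    and k: "\<not> (k \<in> lifted_atlas p A \<and> z \<in> chart_img k \<and> length vs = n)"
  shows "covering_kaehler_form A p f \<omega> k z vs = 0"
proof (cases "k \<in> lifted_atlas p A \<and> z \<in> chart_img k")
  case True
  then obtain V c where V: "k = (V, snd c \<circ> p)" "c \<in> A" "open V" "inj_on p V" "p ` V \<subseteq> fst c"
    using lifted_atlasE by metis
  have "length vs \<noteq> n" using True k by blast
  then show ?thesis
    using covering_kaehler_form_lifted[OF A p \<omega> V] True tensor_field_eq_0[OF \<omega>, of c z vs] by simp
qed (simp only: covering_kaehler_form_def pullback_outside not_False_eq_True mult_zero_right)

text \<open>\<open>twisted_ddbar_exp\<close> transported to a lifted chart: \<psi> is the weighted
  pullback of \<open>h\<close>, and the untwisted operators are the twisted ones for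
  \<open>zero_form\<close>.\<close>

lemma ddbar_lifted:
  assumes A: "complex_atlas A" and p: "covering_space UNIV p UNIV" and \<theta>: "tensor_field A 1 \<theta>"
    and f: "smooth_function (lifted_atlas p A) f"
    and df: "pullback (lifted_atlas p A) A p \<theta> =
         ext_d (lifted_atlas p A) (function_form (lifted_atlas p A) (complex_of_real \<circ> f))"
    and k: "k = (V, snd c \<circ> p)" and c: "c \<in> A" and V: "open V" "inj_on p V" "p ` V \<subseteq> fst c"
    and z: "z \<in> chart_img k"
    and h: "smooth_function A h" and \<psi>: "\<And>y. \<psi> y = exp (- f y) *\<^sub>R h (p y)"
  shows "del (lifted_atlas p A) 0 1 (delbar (lifted_atlas p A) 0 0 (function_form (lifted_atlas p A) \<psi>)) k z [u, v]
    = exp (- f (chart_inv k z)) *\<^sub>R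
      twisted_del A \<theta> 0 1 (twisted_delbar A \<theta> 0 0 (function_form A h)) c z [u, v]"
proof -
  let ?L = "lifted_atlas p A"
  have kL: "k \<in> ?L" unfolding lifted_atlas_def k using c V by blast
  have ok: "open (chart_img k)" by (rule complex_atlas_chart(2)[OF complex_atlas_lifted_atlas[OF A p] kL])
  have lk: "p (chart_inv k y) = chart_inv c y" "y \<in> chart_img c" if "y \<in> chart_img k" for y
    using lifted_chart[OF A c V(3), of y] that unfolding k by blast+
  have oc: "open (chart_img c)" by (rule complex_atlas_chart(2)[OF A c])
  have "smooth_on (chart_img c) (h \<circ> chart_inv c)" using h c unfolding smooth_function_def by blast
  then have sh: "smooth_on (chart_img k) (h \<circ> chart_inv c)"
    by (rule smooth_on_subset) (use lk(2) oc in auto)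
  have sf: "smooth_on (chart_img k) (f \<circ> chart_inv k)" using f kL unfolding smooth_function_def by blast
  have "del ?L 0 1 (delbar ?L 0 0 (function_form ?L \<psi>)) k z [u, v]
      = twisted_ddbar (\<lambda>z v. zero_form k z [v]) (\<psi> \<circ> chart_inv k) z u v"
    unfolding twisted_del_delbar_function_form[OF kL z ok, symmetric] twisted_zero_form ..
  also have "\<dots> = twisted_ddbar (\<lambda>z v. 0) (\<lambda>y. exp (- (f \<circ> chart_inv k) y) *\<^sub>R (h \<circ> chart_inv c) y) z u v"
    by (rule twisted_ddbar_cong_open[OF ok z]) (simp_all add: \<psi> lk(1) zero_form_def)
  also have "\<dots> = exp (- (f \<circ> chart_inv k) z) *\<^sub>R
      twisted_ddbar (\<lambda>z v. \<theta> c z [v]) (h \<circ> chart_inv c) z u v"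
    by (rule twisted_ddbar_exp[OF ok z sh sf]) (rule lee_form_potential[OF A p \<theta> f df k c V])
  also have "twisted_ddbar (\<lambda>z v. \<theta> c z [v]) (h \<circ> chart_inv c) z u v
      = twisted_del A \<theta> 0 1 (twisted_delbar A \<theta> 0 0 (function_form A h)) c z [u, v]"
    by (rule twisted_del_delbar_function_form[OF c lk(2)[OF z] oc, symmetric])
  finally show ?thesis by simp
qed

text \<open>On a lifted chart the second equation is the first multiplied by the nonzero factor
  \<open>exp (- f)\<close>. Each lifted chart lies over a base chart, and each point of a base chart
  is reached by a lifted one, so the local equivalences give the global one.\<close>

lemma potential_iff:
  assumes A: "complex_atlas A" and p: "covering_space UNIV p UNIV" and \<theta>: "tensor_field A 1 \<theta>"
    and f: "smooth_function (lifted_atlas p A) f"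
    and df: "pullback (lifted_atlas p A) A p \<theta> =
         ext_d (lifted_atlas p A) (function_form (lifted_atlas p A) (complex_of_real \<circ> f))"
    and \<omega>: "tensor_field A 2 \<omega>\<^sub>1" "tensor_field A 2 \<omega>\<^sub>2"
    and h: "smooth_function A h" and \<psi>: "\<And>y. \<psi> y = exp (- f y) *\<^sub>R h (p y)"
  shows "\<omega>\<^sub>1 - \<omega>\<^sub>2 = twisted_del A \<theta> 0 1 (twisted_delbar A \<theta> 0 0 (function_form A h)) \<longleftrightarrow>
    covering_kaehler_form A p f \<omega>\<^sub>1 - covering_kaehler_form A p f \<omega>\<^sub>2 =
      del (lifted_atlas p A) 0 1 (delbar (lifted_atlas p A) 0 0 (function_form (lifted_atlas p A) \<psi>))"
    (is "?l = ?r")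
proof -
  let ?L = "lifted_atlas p A"
  let ?T = "twisted_del A \<theta> 0 1 (twisted_delbar A \<theta> 0 0 (function_form A h))"
  let ?D = "del ?L 0 1 (delbar ?L 0 0 (function_form ?L \<psi>))"
  let ?K = "\<lambda>\<omega>. covering_kaehler_form A p f \<omega>"
  have local: "(\<omega>\<^sub>1 - \<omega>\<^sub>2) c z [u, v] = ?T c z [u, v] \<longleftrightarrow> (?K \<omega>\<^sub>1 - ?K \<omega>\<^sub>2) k z [u, v] = ?D k z [u, v]"
    if k: "k = (V, snd c \<circ> p)" "c \<in> A" "open V" "inj_on p V" "p ` V \<subseteq> fst c" and z: "z \<in> chart_img k"
    for V c k z u v
    unfolding ddbar_lifted[OF A p \<theta> f df k z h \<psi>] fun_diff_def
      covering_kaehler_form_lifted[OF A p \<omega>(1) k z] covering_kaehler_form_lifted[OF A p \<omega>(2) k z]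
      scaleR_diff_right[symmetric] scaleR_cancel_left by simp
  have D0: "?D k z vs = 0" if "\<not> (k \<in> ?L \<and> z \<in> chart_img k \<and> length vs = 2)" for k z vs
    using twisted_del_delbar_function_form_eq_0[OF that, of zero_form \<psi>] unfolding twisted_zero_form .
  show ?thesis
  proof
    assume l: ?l
    show ?r
    proof (intro ext)
      fix k z vs
      show "(?K \<omega>\<^sub>1 - ?K \<omega>\<^sub>2) k z vs = ?D k z vs"
      proof (cases "k \<in> ?L \<and> z \<in> chart_img k \<and> length vs = 2")
        case True
        then obtain V c where k: "k = (V, snd c \<circ> p)" "c \<in> A" "open V" "inj_on p V" "p ` V \<subseteq> fst c"
          using lifted_atlasE by metis
        obtain u v where vs: "vs = [u, v]" using True length_2E by blast
        have z: "z \<in> chart_img k" using True by blast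
        show ?thesis unfolding vs local[OF k z, symmetric] l ..
      next
        case False
        then show ?thesis
          unfolding D0[OF False] fun_diff_def covering_kaehler_form_eq_0[OF A p \<omega>(1) False]
            covering_kaehler_form_eq_0[OF A p \<omega>(2) False] by simp
      qed
    qed
  next
    assume r: ?r
    show ?l
    proof (intro ext)
      fix c z vs
      show "(\<omega>\<^sub>1 - \<omega>\<^sub>2) c z vs = ?T c z vs"
      proof (cases "c \<in> A \<and> z \<in> chart_img c \<and> length vs = 2")
        case True
        then have c: "c \<in> A" "z \<in> chart_img c" by blast+
        obtain u v where vs: "vs = [u, v]" using True length_2E by blast
        \<comment> \<open>Surjectivity provides a point over \<open>chart_inv c z\<close>, around
          which a lifted chart with \<open>z\<close> in its image exists.\<close>
        have "p ` UNIV = UNIV" using p unfolding covering_space_def by blast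
        then obtain y where y: "p y = chart_inv c z" by (metis surjD)
        have "p y \<in> fst c" unfolding y by (rule complex_atlas_chart(6)[OF A c])
        then obtain V where yV: "y \<in> V" and V: "open V" "inj_on p V" "p ` V \<subseteq> fst c"
          by (rule lifted_chart_exists[OF A p c(1)])
        have "snd c (p y) = z" unfolding y by (rule complex_atlas_chart(7)[OF A c])
        then have "z \<in> chart_img (V, snd c \<circ> p)"
          using lifted_chart_inv_eq(2)[OF A c(1) V(2,3) yV] by simp
        from local[OF refl c(1) V this, of u v] show ?thesis unfolding vs r by simp
      next
        case False
        then show ?thesis
          unfolding fun_diff_def twisted_del_delbar_function_form_eq_0[OF False]
            tensor_field_eq_0[OF \<omega>(1) False] tensor_field_eq_0[OF \<omega>(2) False] by simp
      qed
    qed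
  qed
qed

lemma tensor_field_zero_form: "tensor_field A n zero_form"
  unfolding tensor_field_def zero_form_def smooth_on_def
  by (simp add: differentiable_order_on_const linear_zero)

section \<open>Equality of Bott--Chern classes and equivalence up to a potential\<close>

theorem proposition4p6:
  fixes A :: "('a::{t2_space,second_countable_topology}, 'n::finite) chart set"
    and \<theta> \<omega>\<^sub>1 \<omega>\<^sub>2 :: "('a, 'n) tensor"
    and p :: "'b::topological_space \<Rightarrow> 'a"
    and f :: "'b \<Rightarrow> real"
  assumes "complex_atlas A"
    and "connected (UNIV :: 'a set)"
    and "lck_form A \<theta> \<omega>\<^sub>1"
    and "lck_form A \<theta> \<omega>\<^sub>2"
    and "connected_galois_covering p"
    and "smooth_function (lifted_atlas p A) f"
    and "pullback (lifted_atlas p A) A p \<theta> =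
         ext_d (lifted_atlas p A) (function_form (lifted_atlas p A) (complex_of_real \<circ> f))"
  shows "bott_chern_class A \<theta> \<omega>\<^sub>1 = bott_chern_class A \<theta> \<omega>\<^sub>2 \<longleftrightarrow>
         equivalent_up_to_potential A p f \<omega>\<^sub>1 \<omega>\<^sub>2"
proof -
  note A = assms(1) and f = assms(6) and df = assms(7)
  let ?L = "lifted_atlas p A"
  let ?D = "\<lambda>\<psi>. del ?L 0 1 (delbar ?L 0 0 (function_form ?L \<psi>))"
  let ?K = "\<lambda>\<omega>. covering_kaehler_form A p f \<omega>"
  have p: "covering_space UNIV p UNIV" and conn: "connected (UNIV :: 'b set)"
    and galois: "\<And>x y. p x = p y \<Longrightarrow> \<exists>\<gamma>\<in>deck_group p. \<gamma> x = y"
    using assms(5) unfolding connected_galois_covering_def by blast+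
  have L: "complex_atlas ?L" by (rule complex_atlas_lifted_atlas[OF A p])
  have \<theta>: "tensor_field A 1 \<theta>" using assms(3) unfolding lck_form_def diff_form_def by blast
  have \<omega>: "tensor_field A 2 \<omega>\<^sub>1" "tensor_field A 2 \<omega>\<^sub>2"
    using lck_form_tensor_field[OF A assms(3)] lck_form_tensor_field[OF A assms(4)] by blast+
  have chi: "0 < deck_character f \<gamma>" "exp (- f (\<gamma> x)) = deck_character f \<gamma> * exp (- f x)"
    if "\<gamma> \<in> deck_group p" for \<gamma> x
    by (rule deck_character_works[of f \<gamma>, OF deck_group_potential_shift[OF A p conn \<theta> f df that]])+
  have p_deck: "p (\<gamma> x) = p x" if "\<gamma> \<in> deck_group p" for \<gamma> x
    using that unfolding deck_group_def by (auto simp: fun_eq_iff)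
  have lifted: "chart_img k \<subseteq> chart_img c" "open (chart_img k)" "open (chart_img c)" "k \<in> ?L"
    "smooth_on (chart_img k) (f \<circ> chart_inv k)" "\<And>z. z \<in> chart_img k \<Longrightarrow> p (chart_inv k z) = chart_inv c z"
    if k: "k = (V, snd c \<circ> p)" "c \<in> A" "open V" "inj_on p V" "p ` V \<subseteq> fst c" for k V c
  proof -
    show kL: "k \<in> ?L" unfolding lifted_atlas_def using k by blast
    show "smooth_on (chart_img k) (f \<circ> chart_inv k)" using f kL unfolding smooth_function_def by blast
    show "open (chart_img k)" "open (chart_img c)"
      by (rule complex_atlas_chart(2)[OF L kL] complex_atlas_chart(2)[OF A k(2)])+
    show "chart_img k \<subseteq> chart_img c" "\<And>z. z \<in> chart_img k \<Longrightarrow> p (chart_inv k z) = chart_inv c z"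
      using lifted_chart(2,3)[OF A k(2,5)] unfolding k(1) by blast+
  qed
  show ?thesis
    unfolding bott_chern_class_eq_iff[OF A \<theta> lck_form_bott_chern_closed[OF A assms(3)]
        lck_form_bott_chern_closed[OF A assms(4)]]
  proof
    assume "\<exists>h. smooth_function A h \<and> \<omega>\<^sub>1 - \<omega>\<^sub>2 = twisted_del A \<theta> 0 1 (twisted_delbar A \<theta> 0 0 (function_form A h))"
    then obtain h where h: "smooth_function A h"
      and eq: "\<omega>\<^sub>1 - \<omega>\<^sub>2 = twisted_del A \<theta> 0 1 (twisted_delbar A \<theta> 0 0 (function_form A h))" by blast
    define \<psi> where "\<psi> y = exp (- f y) *\<^sub>R h (p y)" for y
    \<comment> \<open>The difference of the Kaehler forms is real, so by \<open>ddbar_Im\<close> it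
      is \<i> times \<open>?D\<close> of the imaginary part of \<psi>, the required shape.\<close>
    define \<phi> where "\<phi> y = Im (\<psi> y)" for y
    have K: "?K \<omega>\<^sub>1 - ?K \<omega>\<^sub>2 = ?D \<psi>"
      using potential_iff[OF A p \<theta> f df \<omega> h \<psi>_def] eq by blast
    have \<psi>: "smooth_function ?L \<psi>"
      unfolding smooth_function_def
    proof
      fix k assume "k \<in> ?L"
      then obtain V c where k: "k = (V, snd c \<circ> p)" "c \<in> A" "open V" "inj_on p V" "p ` V \<subseteq> fst c"
        using lifted_atlasE by metis
      note l = lifted[OF k]
      have "smooth_on (chart_img c) (h \<circ> chart_inv c)"
        using h k(2) unfolding smooth_function_def by blast
      then have h': "smooth_on (chart_img k) (h \<circ> chart_inv c)"
        by (rule smooth_on_subset) (rule l(1), rule l(3))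
      have e: "smooth_on (chart_img k) (\<lambda>z. exp (- (f \<circ> chart_inv k) z))"
        by (rule smooth_on_exp[OF l(2) smooth_on_bounded_linear[OF l(2) bounded_linear_minus[OF bounded_linear_ident] l(5)]])
      have "(\<psi> \<circ> chart_inv k) z = exp (- (f \<circ> chart_inv k) z) *\<^sub>R (h \<circ> chart_inv c) z"
        if "z \<in> chart_img k" for z
        using l(6)[OF that] by (simp add: \<psi>_def)
      from iffD2[OF smooth_on_cong[OF l(2) this]
          smooth_on_bounded_bilinear[OF l(2) bounded_bilinear_scaleR e h']]
      show "smooth_on (chart_img k) (\<psi> \<circ> chart_inv k)" .
    qed
    have "smooth_function ?L \<phi>"
      unfolding \<phi>_def by (rule smooth_function_bounded_linear[OF L bounded_linear_Im \<psi>])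
    moreover have "?K \<omega>\<^sub>1 - ?K \<omega>\<^sub>2 = (\<lambda>c z vs. \<i> * ?D (complex_of_real \<circ> \<phi>) c z vs)"
      unfolding K
    proof (intro ext)
      fix k z vs
      show "?D \<psi> k z vs = \<i> * ?D (complex_of_real \<circ> \<phi>) k z vs"
      proof (cases "k \<in> ?L \<and> z \<in> chart_img k \<and> length vs = 2")
        case True
        then have k: "k \<in> ?L" "z \<in> chart_img k" by blast+
        have ok: "open (chart_img k)" by (rule complex_atlas_chart(2)[OF L k(1)])
        obtain u v where vs: "vs = [u, v]" using True length_2E by blast
        have D: "?D g k z [u, v] = twisted_ddbar (\<lambda>z v. 0) (g \<circ> chart_inv k) z u v" for g
          using twisted_del_delbar_function_form[OF k ok, of zero_form g u v]
          unfolding twisted_zero_form unfolding zero_form_def .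
        have "?K \<omega>\<^sub>1 k z [u, v] - ?K \<omega>\<^sub>2 k z [u, v] \<in> \<real>"
          unfolding covering_kaehler_form_def pullback_def Let_def
          using lck_form_real[OF assms(3)] lck_form_real[OF assms(4)] by auto
        then have "twisted_ddbar (\<lambda>z v. 0) (\<psi> \<circ> chart_inv k) z u v \<in> \<real>"
          unfolding D[symmetric] K[symmetric] by simp
        moreover have "smooth_on (chart_img k) (\<psi> \<circ> chart_inv k)"
          using \<psi> k(1) unfolding smooth_function_def by blast
        ultimately show ?thesis
          unfolding vs D using ddbar_Im[OF ok k(2), of "\<psi> \<circ> chart_inv k" u v]
          by (simp add: comp_def \<phi>_def)
      next
        case False
        then show ?thesis
          using twisted_del_delbar_function_form_eq_0[OF False, of zero_form]
          unfolding twisted_zero_form by simp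
      qed
    qed
    \<comment> \<open>The factor \<open>h (p y)\<close> is deck invariant, so only the weight picks
      up the character, which is real and passes through \<open>Im\<close>.\<close>
    moreover have "\<phi> (\<gamma> x) = deck_character f \<gamma> * \<phi> x" if "\<gamma> \<in> deck_group p" for \<gamma> x
      unfolding \<phi>_def \<psi>_def p_deck[OF that] chi(2)[OF that] by simp
    ultimately show "equivalent_up_to_potential A p f \<omega>\<^sub>1 \<omega>\<^sub>2"
      unfolding equivalent_up_to_potential_def by blast
  next
    assume "equivalent_up_to_potential A p f \<omega>\<^sub>1 \<omega>\<^sub>2"
    then obtain \<phi> where \<phi>: "smooth_function ?L \<phi>"
      and K: "?K \<omega>\<^sub>1 - ?K \<omega>\<^sub>2 = (\<lambda>c z vs. \<i> * ?D (complex_of_real \<circ> \<phi>) c z vs)"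
      and equi: "\<And>\<gamma> x. \<gamma> \<in> deck_group p \<Longrightarrow> \<phi> (\<gamma> x) = deck_character f \<gamma> * \<phi> x"
      unfolding equivalent_up_to_potential_def by blast
    \<comment> \<open>\<open>inv p\<close> picks some point of each fibre; \<open>exp f\<close>
      undoes the weight, and the factor \<i> of the potential equation is absorbed into the complex
      function \<open>h\<close>.\<close>
    define h where "h x = exp (f (inv p x)) *\<^sub>R (\<i> * complex_of_real (\<phi> (inv p x)))" for x
    have surj: "surj p" using p unfolding covering_space_def by blast
    \<comment> \<open>Two points of a fibre differ by a deck transformation, under which \<phi>
      acquires the character and \<open>exp f\<close> its inverse. The value of \<open>h\<close> is
      thus independent of the choice made by \<open>inv p\<close>.\<close>
    have h_p: "h (p y) = exp (f y) *\<^sub>R (\<i> * complex_of_real (\<phi> y))" for y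
    proof -
      have "p y = p (inv p (p y))" by (simp add: surj_f_inv_f[OF surj])
      from galois[OF this] obtain \<gamma> where \<gamma>: "\<gamma> \<in> deck_group p" "\<gamma> y = inv p (p y)" by blast
      have "exp (f y) = exp (f y) * (exp (f (\<gamma> y)) * exp (- f (\<gamma> y)))"
        by (simp flip: exp_add)
      also have "\<dots> = (exp (f y) * exp (- f y)) * (exp (f (\<gamma> y)) * deck_character f \<gamma>)"
        unfolding chi(2)[OF \<gamma>(1)] by (simp only: ac_simps)
      also have "exp (f y) * exp (- f y) = 1" by (simp flip: exp_add)
      finally have "exp (f (\<gamma> y)) * \<phi> (\<gamma> y) = exp (f y) * \<phi> y"
        unfolding equi[OF \<gamma>(1)] by simp
      moreover have "a *\<^sub>R (\<i> * complex_of_real b) = \<i> * complex_of_real (a * b)" for a b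
        by (simp add: scaleR_conv_of_real)
      ultimately show ?thesis unfolding h_def \<gamma>(2)[symmetric] by (simp only:)
    qed
    define \<psi> where "\<psi> y = \<i> * complex_of_real (\<phi> y)" for y
    have \<psi>_h: "\<psi> y = exp (- f y) *\<^sub>R h (p y)" for y
      unfolding \<psi>_def h_p by (simp flip: exp_add)
    have L\<i>: "bounded_linear (\<lambda>r. \<i> * complex_of_real r)"
      by (rule bounded_linear_compose[OF bounded_linear_mult_right bounded_linear_of_real])
    have h: "smooth_function A h"
      unfolding smooth_function_def
    proof
      fix c assume c: "c \<in> A"
      show "smooth_on (chart_img c) (h \<circ> chart_inv c)"
      \<comment> \<open>\<open>inv p\<close> need not be continuous, but by \<open>h_p\<close> the
        function \<open>h\<close> is expressed near each point through the inverse of a lifted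
        chart, where \<phi> and \<open>f\<close> are smooth.\<close>
      proof (rule smooth_on_local)
        fix z assume z: "z \<in> chart_img c"
        obtain y where y: "p y = chart_inv c z" using surj by (metis surjD)
        have "p y \<in> fst c" unfolding y by (rule complex_atlas_chart(6)[OF A c z])
        then obtain V where yV: "y \<in> V" and V: "open V" "inj_on p V" "p ` V \<subseteq> fst c"
          by (rule lifted_chart_exists[OF A p c])
        define k where k: "k = (V, snd c \<circ> p)"
        note l = lifted[OF k c V]
        have "snd c (p y) = z" unfolding y by (rule complex_atlas_chart(7)[OF A c z])
        then have zk: "z \<in> chart_img k"
          using lifted_chart_inv_eq(2)[OF A c V(2,3) yV] unfolding k by simp
        have "smooth_on (chart_img k) (\<phi> \<circ> chart_inv k)"
          using \<phi> l(4) unfolding smooth_function_def by blast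
        then have e: "smooth_on (chart_img k)
            (\<lambda>w. exp ((f \<circ> chart_inv k) w) *\<^sub>R (\<i> * complex_of_real ((\<phi> \<circ> chart_inv k) w)))"
          by (rule smooth_on_bounded_bilinear[OF l(2) bounded_bilinear_scaleR smooth_on_exp[OF l(2,5)]
                smooth_on_bounded_linear[OF l(2) L\<i>]])
        have "(h \<circ> chart_inv c) w = exp ((f \<circ> chart_inv k) w) *\<^sub>R (\<i> * complex_of_real ((\<phi> \<circ> chart_inv k) w))"
          if "w \<in> chart_img k" for w
          using l(6)[OF that] h_p[of "chart_inv k w"] by simp
        from iffD2[OF smooth_on_cong[OF l(2) this] e]
        have "smooth_on (chart_img k) (h \<circ> chart_inv c)" .
        with zk l(2) show "\<exists>W. open W \<and> z \<in> W \<and> smooth_on W (h \<circ> chart_inv c)" by blast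
      qed
    qed
    have "?D \<psi> k z vs = \<i> * ?D (complex_of_real \<circ> \<phi>) k z vs" for k z vs
      using twisted_del_delbar_cmult[OF L tensor_field_zero_form
          smooth_function_bounded_linear[OF L bounded_linear_of_real \<phi>], of \<i> k z vs]
      unfolding twisted_zero_form \<psi>_def comp_def .
    then have "?K \<omega>\<^sub>1 - ?K \<omega>\<^sub>2 = ?D \<psi>" unfolding K by (intro ext) simp
    with potential_iff[OF A p \<theta> f df \<omega> h \<psi>_h]
    show "\<exists>h. smooth_function A h \<and> \<omega>\<^sub>1 - \<omega>\<^sub>2 = twisted_del A \<theta> 0 1 (twisted_delbar A \<theta> 0 0 (function_form A h))"
      using h by blast
  qed
qed

end
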